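(* If a complete theory $T$ is $\mathrm{NBTP}$, then $T$ satisfies New Kim's Lemma.
   Context: Let $\omega^{<\omega}_*$ be the set of nonempty finite sequences of natural numbers, ordered by initial segment $\trianglelefteq$. A left-leaning path is a sequence $(\lambda_n)$ in $\omega^{<\omega}_*$ such that if $\lambda_n=\eta^\frown\langle i\rangle$ then $\eta^\frown\langle j\rangle\vartriangleleft\lambda_{n+1}$ (strict initial segment) for some $j\le i$. A right-veering path is a sequence $(\rho_n)$ such that if $\rho_n=\eta^\frown\langle i\rangle$ then $\eta^\frown\langle j\rangle\trianglelefteq\rho_{n+1}$ for some $j>i$. A formula $\varphi(x;y)$ has $k$-$\mathrm{BTP}$ if there is $(a_\eta)_{\eta\in\omega^{<\omega}_*}$ with $\{\varphi(x;a_{\lambda_n}):n<\omega\}$ consistent for every left-leaning path and $\{\varphi(x;a_{\rho_n}):n<\omega\}$ $k$-inconsistent for every right-veering path; $T$ is $\mathrm{NBTP}$ if no formula has $k$-$\mathrm{BTP}$ for any $k$. Work in a monster $\mathbb{M}$. A global type $q$ is $M$-invariant if for all $\varphi(x;y)$ and $c\equiv_M c'$, $\varphi(x;c)\in q$ iff $\varphi(x;c')\in q$; a Morley sequence over $M$ for $q$ is $(b_i)$ with $b_i\models q|_{Mb_{<i}}$. $\varphi(x;b)$ Kim-divides over $M$ if $\{\varphi(x;b_i)\}$ is inconsistent for a Morley sequence of some global $M$-invariant extension of $\mathrm{tp}(b/M)$; Kim-forks if it implies a finite disjunction of Kim-dividing formulas; $A\mathop{\smile\!\!\!\!\!\mid}^K_M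 B$ if $\mathrm{tp}(A/MB)$ has no Kim-forking formula. A global $M$-invariant $p$ is Kim-strict if for all $B$ and $a\models p|_{MB}$, $B\mathop{\smile\!\!\!\!\!\mid}^K_M a$. $T$ satisfies New Kim's Lemma if for every model $M$, whenever $\varphi(x;b)$ Kim-divides over $M$, it divides along Morley sequences of every global Kim-strict $M$-invariant type extending $\mathrm{tp}(b/M)$. *)

theory Defs
  imports Main "HOL-Library.Sublist"
begin

unbundle cardinal_syntax

section \<open>First-order logic with equality\<close>

record ('f, 'r) lang =
  Funs :: "'f set"
  Rels :: "'r set"
  farity :: "'f \<Rightarrow> nat"
  rarity :: "'r \<Rightarrow> nat"

datatype 'f tm = Var nat | Fn 'f "'f tm list"

datatype ('f, 'r) fm =
    Eq "'f tm" "'f tm"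
  | Rel 'r "'f tm list"
  | Neg "('f, 'r) fm"
  | Conj "('f, 'r) fm" "('f, 'r) fm"
  | Ex nat "('f, 'r) fm"

fun wf_tm :: "('f, 'r) lang \<Rightarrow> 'f tm \<Rightarrow> bool" where
  "wf_tm L (Var i) = True"
| "wf_tm L (Fn f ts) = (f \<in> Funs L \<and> length ts = farity L f \<and> (\<forall>t\<in>set ts. wf_tm L t))"

fun wf_fm :: "('f, 'r) lang \<Rightarrow> ('f, 'r) fm \<Rightarrow> bool" where
  "wf_fm L (Eq t u) = (wf_tm L t \<and> wf_tm L u)"
| "wf_fm L (Rel r ts) = (r \<in> Rels L \<and> length ts = rarity L r \<and> (\<forall>t\<in>set ts. wf_tm L t))"
| "wf_fm L (Neg p) = wf_fm L p"
| "wf_fm L (Conj p q) = (wf_fm L p \<and> wf_fm L q)"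
| "wf_fm L (Ex i p) = wf_fm L p"

fun fv_tm :: "'f tm \<Rightarrow> nat set" where
  "fv_tm (Var i) = {i}"
| "fv_tm (Fn f ts) = (\<Union>t\<in>set ts. fv_tm t)"

fun fv :: "('f, 'r) fm \<Rightarrow> nat set" where
  "fv (Eq t u) = fv_tm t \<union> fv_tm u"
| "fv (Rel r ts) = (\<Union>t\<in>set ts. fv_tm t)"
| "fv (Neg p) = fv p"
| "fv (Conj p q) = fv p \<union> fv q"
| "fv (Ex i p) = fv p - {i}"

record ('f, 'r, 'a) struct =
  univ :: "'a set"
  fint :: "'f \<Rightarrow> 'a list \<Rightarrow> 'a"
  rint :: "'r \<Rightarrow> 'a list \<Rightarrow> bool"

definition is_struct :: "('f, 'r) lang \<Rightarrow> ('f, 'r, 'a) struct \<Rightarrow> bool" where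
  "is_struct L N \<longleftrightarrow> univ N \<noteq> {} \<and>
     (\<forall>f\<in>Funs L. \<forall>as\<in>lists (univ N). length as = farity L f \<longrightarrow> fint N f as \<in> univ N)"

fun eval_tm :: "('f, 'r, 'a) struct \<Rightarrow> (nat \<Rightarrow> 'a) \<Rightarrow> 'f tm \<Rightarrow> 'a" where
  "eval_tm N e (Var i) = e i"
| "eval_tm N e (Fn f ts) = fint N f (map (eval_tm N e) ts)"

fun sat :: "('f, 'r, 'a) struct \<Rightarrow> (nat \<Rightarrow> 'a) \<Rightarrow> ('f, 'r) fm \<Rightarrow> bool" where
  "sat N e (Eq t u) = (eval_tm N e t = eval_tm N e u)"
| "sat N e (Rel r ts) = rint N r (map (eval_tm N e) ts)"
| "sat N e (Neg p) = (\<not> sat N e p)"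
| "sat N e (Conj p q) = (sat N e p \<and> sat N e q)"
| "sat N e (Ex i p) = (\<exists>d\<in>univ N. sat N (e(i := d)) p)"

definition sentences :: "('f, 'r) lang \<Rightarrow> ('f, 'r) fm set" where
  "sentences L = {\<sigma>. wf_fm L \<sigma> \<and> fv \<sigma> = {}}"

definition models :: "('f, 'r) lang \<Rightarrow> ('f, 'r, 'a) struct \<Rightarrow> ('f, 'r) fm set \<Rightarrow> bool" where
  "models L N T \<longleftrightarrow> is_struct L N \<and> (\<forall>\<sigma>\<in>T. \<forall>e. range e \<subseteq> univ N \<longrightarrow> sat N e \<sigma>)"

text \<open>The structures quantified over below have their universes inside the type of formulas.
  That type has at least as many elements as the language has formulas, so by the downward
  Loewenheim-Skolem theorem this is semantic consequence over arbitrary models.\<close>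

definition entails :: "('f, 'r) lang \<Rightarrow> ('f, 'r) fm set \<Rightarrow> ('f, 'r) fm \<Rightarrow> bool" where
  "entails L T \<sigma> \<longleftrightarrow> (\<forall>N :: ('f, 'r, ('f, 'r) fm) struct. models L N T \<longrightarrow> models L N {\<sigma>})"

definition complete_theory :: "('f, 'r) lang \<Rightarrow> ('f, 'r) fm set \<Rightarrow> bool" where
  "complete_theory L T \<longleftrightarrow> T \<subseteq> sentences L \<and>
     (\<exists>N :: ('f, 'r, ('f, 'r) fm) struct. models L N T) \<and>
     (\<forall>\<sigma>\<in>sentences L. entails L T \<sigma> \<or> entails L T (Neg \<sigma>))"

section \<open>Formulas with parameters and types\<close>

text \<open>Finite tuples are lists. A formula \<open>\<phi>(x;y)\<close> with \<open>x\<close> of length \<open>n\<close> and \<open>y\<close> of length \<open>m\<close> is a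
  formula in the variables below \<open>n + m\<close>, the first \<open>n\<close> being \<open>x\<close> and the next \<open>m\<close> being \<open>y\<close>.
  Its instance \<open>\<phi>(x;c)\<close> is the pair \<open>(\<phi>, c)\<close>, so that \<open>\<phi>(a;c)\<close> is \<open>holds N \<phi> (a @ c)\<close>. In \<open>holds\<close>
  the value of the assignment beyond the length of the tuple is never consulted for such formulas.\<close>

definition tuples :: "('f, 'r, 'a) struct \<Rightarrow> nat \<Rightarrow> 'a list set" where
  "tuples N n = {a \<in> lists (univ N). length a = n}"

definition formulas :: "('f, 'r) lang \<Rightarrow> nat \<Rightarrow> ('f, 'r) fm set" where
  "formulas L n = {\<phi>. wf_fm L \<phi> \<and> fv \<phi> \<subseteq> {..<n}}"

definition holds :: "('f, 'r, 'a) struct \<Rightarrow> ('f, 'r) fm \<Rightarrow> 'a list \<Rightarrow> bool" where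
  "holds N \<phi> a \<longleftrightarrow> sat N (\<lambda>i. a ! i) \<phi>"

type_synonym ('f, 'r, 'a) pfm = "('f, 'r) fm \<times> 'a list"

definition pformulas :: "('f, 'r) lang \<Rightarrow> nat \<Rightarrow> 'a set \<Rightarrow> ('f, 'r, 'a) pfm set" where
  "pformulas L n A = {(\<phi>, c). c \<in> lists A \<and> \<phi> \<in> formulas L (n + length c)}"

definition realizes :: "('f, 'r, 'a) struct \<Rightarrow> nat \<Rightarrow> 'a list \<Rightarrow> ('f, 'r, 'a) pfm set \<Rightarrow> bool" where
  "realizes N n a p \<longleftrightarrow> a \<in> tuples N n \<and> (\<forall>(\<phi>, c)\<in>p. holds N \<phi> (a @ c))"

text \<open>Consistency is with the elementary diagram of \<open>N\<close>, i.e. finite satisfiability in \<open>N\<close>.\<close>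

definition consistent :: "('f, 'r, 'a) struct \<Rightarrow> nat \<Rightarrow> ('f, 'r, 'a) pfm set \<Rightarrow> bool" where
  "consistent N n p \<longleftrightarrow> (\<forall>F. finite F \<and> F \<subseteq> p \<longrightarrow> (\<exists>a. realizes N n a F))"

definition complete_types ::
  "('f, 'r) lang \<Rightarrow> ('f, 'r, 'a) struct \<Rightarrow> nat \<Rightarrow> 'a set \<Rightarrow> ('f, 'r, 'a) pfm set set" where
  "complete_types L N n A =
     {p. p \<subseteq> pformulas L n A \<and> consistent N n p \<and>
         (\<forall>(\<phi>, c)\<in>pformulas L n A. (\<phi>, c) \<in> p \<or> (Neg \<phi>, c) \<in> p)}"

definition tp ::
  "('f, 'r) lang \<Rightarrow> ('f, 'r, 'a) struct \<Rightarrow> 'a list \<Rightarrow> 'a set \<Rightarrow> ('f, 'r, 'a) pfm set" where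
  "tp L N a A = {(\<phi>, c) \<in> pformulas L (length a) A. holds N \<phi> (a @ c)}"

definition restrict_type :: "('f, 'r, 'a) pfm set \<Rightarrow> 'a set \<Rightarrow> ('f, 'r, 'a) pfm set" where
  "restrict_type p A = {(\<phi>, c) \<in> p. c \<in> lists A}"

definition elem_submodel ::
  "('f, 'r) lang \<Rightarrow> 'a set \<Rightarrow> ('f, 'r, 'a) struct \<Rightarrow> bool" where
  "elem_submodel L M N \<longleftrightarrow> M \<subseteq> univ N \<and> is_struct L (N\<lparr>univ := M\<rparr>) \<and>
     (\<forall>\<phi> e. wf_fm L \<phi> \<and> range e \<subseteq> M \<longrightarrow> (sat (N\<lparr>univ := M\<rparr>) e \<phi> \<longleftrightarrow> sat N e \<phi>))"

section \<open>Monster models\<close>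

definition small :: "'k rel \<Rightarrow> 'a set \<Rightarrow> bool" where
  "small \<kappa> A \<longleftrightarrow> |A| <o \<kappa>"

definition saturated :: "'k rel \<Rightarrow> ('f, 'r) lang \<Rightarrow> ('f, 'r, 'a) struct \<Rightarrow> bool" where
  "saturated \<kappa> L N \<longleftrightarrow>
     (\<forall>A n. A \<subseteq> univ N \<and> small \<kappa> A \<longrightarrow>
        (\<forall>p\<in>complete_types L N n A. \<exists>a. realizes N n a p))"

definition elementary_map ::
  "('f, 'r) lang \<Rightarrow> ('f, 'r, 'a) struct \<Rightarrow> 'a set \<Rightarrow> ('a \<Rightarrow> 'a) \<Rightarrow> bool" where
  "elementary_map L N A f \<longleftrightarrow> f ` A \<subseteq> univ N \<and>
     (\<forall>a\<in>lists A. \<forall>\<phi>\<in>formulas L (length a). holds N \<phi> a \<longleftrightarrow> holds N \<phi> (map f a))"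

definition automorphism ::
  "('f, 'r) lang \<Rightarrow> ('f, 'r, 'a) struct \<Rightarrow> ('a \<Rightarrow> 'a) \<Rightarrow> bool" where
  "automorphism L N \<sigma> \<longleftrightarrow> bij_betw \<sigma> (univ N) (univ N) \<and>
     (\<forall>f\<in>Funs L. \<forall>a\<in>tuples N (farity L f). \<sigma> (fint N f a) = fint N f (map \<sigma> a)) \<and>
     (\<forall>r\<in>Rels L. \<forall>a\<in>tuples N (rarity L r). rint N r a \<longleftrightarrow> rint N r (map \<sigma> a))"

definition strongly_homogeneous :: "'k rel \<Rightarrow> ('f, 'r) lang \<Rightarrow> ('f, 'r, 'a) struct \<Rightarrow> bool" where
  "strongly_homogeneous \<kappa> L N \<longleftrightarrow>
     (\<forall>A f. A \<subseteq> univ N \<and> small \<kappa> A \<and> elementary_map L N A f \<longrightarrow>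
        (\<exists>\<sigma>. automorphism L N \<sigma> \<and> (\<forall>a\<in>A. \<sigma> a = f a)))"

definition monster ::
  "'k rel \<Rightarrow> ('f, 'r) lang \<Rightarrow> ('f, 'r) fm set \<Rightarrow> ('f, 'r, 'a) struct \<Rightarrow> bool" where
  "monster \<kappa> L T N \<longleftrightarrow> Card_order \<kappa> \<and> natLeq <o \<kappa> \<and> |Funs L <+> Rels L| <o \<kappa> \<and>
     models L N T \<and> saturated \<kappa> L N \<and> strongly_homogeneous \<kappa> L N"

section \<open>The bizarre tree property\<close>

definition left_leaning :: "(nat \<Rightarrow> nat list) \<Rightarrow> bool" where
  "left_leaning l \<longleftrightarrow> (\<forall>n. l n \<noteq> []) \<and>
     (\<forall>n \<eta> i. l n = \<eta> @ [i] \<longrightarrow> (\<exists>j\<le>i. strict_prefix (\<eta> @ [j]) (l (Suc n))))"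

definition right_veering :: "(nat \<Rightarrow> nat list) \<Rightarrow> bool" where
  "right_veering r \<longleftrightarrow> (\<forall>n. r n \<noteq> []) \<and>
     (\<forall>n \<eta> i. r n = \<eta> @ [i] \<longrightarrow> (\<exists>j>i. prefix (\<eta> @ [j]) (r (Suc n))))"

text \<open>\<open>k\<close>-inconsistency refers to \<open>k\<close> distinct indices, not to \<open>k\<close> distinct formulas: with the latter
  reading a constant family would be vacuously 2-inconsistent.\<close>

definition k_inconsistent ::
  "('f, 'r, 'a) struct \<Rightarrow> nat \<Rightarrow> nat \<Rightarrow> (nat \<Rightarrow> ('f, 'r, 'a) pfm) \<Rightarrow> bool" where
  "k_inconsistent N n k F \<longleftrightarrow> (\<forall>I. finite I \<and> card I = k \<longrightarrow> \<not> consistent N n (F ` I))"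

text \<open>\<open>n\<close> and \<open>m\<close> are the lengths of \<open>x\<close> and \<open>y\<close> in \<open>\<phi>(x;y)\<close>; the value of the tree at the empty
  sequence plays no role.\<close>

definition has_BTP :: "('f, 'r, 'a) struct \<Rightarrow> nat \<Rightarrow> nat \<Rightarrow> ('f, 'r) fm \<Rightarrow> nat \<Rightarrow> bool" where
  "has_BTP N n m \<phi> k \<longleftrightarrow>
     (\<exists>a :: nat list \<Rightarrow> 'a list.
        (\<forall>\<eta>. \<eta> \<noteq> [] \<longrightarrow> a \<eta> \<in> tuples N m) \<and>
        (\<forall>l. left_leaning l \<longrightarrow> consistent N n (range (\<lambda>i. (\<phi>, a (l i))))) \<and>
        (\<forall>r. right_veering r \<longrightarrow> k_inconsistent N n k (\<lambda>i. (\<phi>, a (r i)))))"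

definition NBTP :: "('f, 'r) lang \<Rightarrow> ('f, 'r, 'a) struct \<Rightarrow> bool" where
  "NBTP L N \<longleftrightarrow> (\<forall>n m k. \<forall>\<phi>\<in>formulas L (n + m). \<not> has_BTP N n m \<phi> k)"

section \<open>Kim-independence and New Kim's Lemma\<close>

definition invariant_type ::
  "('f, 'r) lang \<Rightarrow> ('f, 'r, 'a) struct \<Rightarrow> 'a set \<Rightarrow> nat \<Rightarrow> ('f, 'r, 'a) pfm set \<Rightarrow> bool" where
  "invariant_type L N M n q \<longleftrightarrow> q \<in> complete_types L N n (univ N) \<and>
     (\<forall>m. \<forall>\<phi>\<in>formulas L (n + m). \<forall>c\<in>tuples N m. \<forall>c'\<in>tuples N m.
        tp L N c M = tp L N c' M \<longrightarrow> ((\<phi>, c) \<in> q \<longleftrightarrow> (\<phi>, c') \<in> q))"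

definition morley_seq ::
  "('f, 'r, 'a) struct \<Rightarrow> 'a set \<Rightarrow> nat \<Rightarrow> ('f, 'r, 'a) pfm set \<Rightarrow> (nat \<Rightarrow> 'a list) \<Rightarrow> bool" where
  "morley_seq N M n q b \<longleftrightarrow>
     (\<forall>i. realizes N n (b i) (restrict_type q (M \<union> (\<Union>j<i. set (b j)))))"

text \<open>In the following definitions \<open>n\<close> is the length of \<open>x\<close> in \<open>\<phi>(x;b)\<close>.\<close>

definition kim_divides ::
  "('f, 'r) lang \<Rightarrow> ('f, 'r, 'a) struct \<Rightarrow> 'a set \<Rightarrow> nat \<Rightarrow> ('f, 'r) fm \<Rightarrow> 'a list \<Rightarrow> bool" where
  "kim_divides L N M n \<phi> b \<longleftrightarrow>
     (\<exists>q c. invariant_type L N M (length b) q \<and> tp L N b M \<subseteq> q \<and>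
        morley_seq N M (length b) q c \<and> \<not> consistent N n (range (\<lambda>i. (\<phi>, c i))))"

definition kim_forks ::
  "('f, 'r) lang \<Rightarrow> ('f, 'r, 'a) struct \<Rightarrow> 'a set \<Rightarrow> nat \<Rightarrow> ('f, 'r) fm \<Rightarrow> 'a list \<Rightarrow> bool" where
  "kim_forks L N M n \<phi> b \<longleftrightarrow>
     (\<exists>D. finite D \<and> D \<subseteq> pformulas L n (univ N) \<and>
        (\<forall>(\<psi>, c)\<in>D. kim_divides L N M n \<psi> c) \<and>
        (\<forall>a\<in>tuples N n. holds N \<phi> (a @ b) \<longrightarrow> (\<exists>(\<psi>, c)\<in>D. holds N \<psi> (a @ c))))"

text \<open>A formula in the type of a possibly infinite set \<open>A\<close> belongs to the type of a finite tuple
  from \<open>A\<close>.\<close>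

definition kim_indep ::
  "('f, 'r) lang \<Rightarrow> ('f, 'r, 'a) struct \<Rightarrow> 'a set \<Rightarrow> 'a set \<Rightarrow> 'a set \<Rightarrow> bool" where
  "kim_indep L N M A B \<longleftrightarrow>
     (\<forall>a\<in>lists A. \<forall>(\<phi>, c)\<in>tp L N a (M \<union> B). \<not> kim_forks L N M (length a) \<phi> c)"

definition kim_strict ::
  "'k rel \<Rightarrow> ('f, 'r) lang \<Rightarrow> ('f, 'r, 'a) struct \<Rightarrow> 'a set \<Rightarrow> nat \<Rightarrow> ('f, 'r, 'a) pfm set \<Rightarrow> bool"
  where
  "kim_strict \<kappa> L N M n p \<longleftrightarrow> invariant_type L N M n p \<and>
     (\<forall>B a. B \<subseteq> univ N \<and> small \<kappa> B \<and> realizes N n a (restrict_type p (M \<union> B)) \<longrightarrow>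
        kim_indep L N M B (set a))"

definition new_kims_lemma :: "'k rel \<Rightarrow> ('f, 'r) lang \<Rightarrow> ('f, 'r, 'a) struct \<Rightarrow> bool" where
  "new_kims_lemma \<kappa> L N \<longleftrightarrow>
     (\<forall>M n \<phi> b. elem_submodel L M N \<and> small \<kappa> M \<and> (\<phi>, b) \<in> pformulas L n (univ N) \<and>
        kim_divides L N M n \<phi> b \<longrightarrow>
        (\<forall>p c. kim_strict \<kappa> L N M (length b) p \<and> tp L N b M \<subseteq> p \<and>
           morley_seq N M (length b) p c \<longrightarrow>
           \<not> consistent N n (range (\<lambda>i. (\<phi>, c i)))))"

end

theory Submission
  imports Defs "HOL-Library.Countable"
begin

text \<open>Suppose that \<open>\<phi>(x;b)\<close> Kim-divides over \<open>M\<close> along \<open>q\<close>, while it is consistent along the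
  Kim-strict type \<open>p\<close>. A tree with the bizarre tree property is one in which every node realizes
  \<open>p\<close> over the strict descendants of each of its weakly left siblings, and \<open>q\<close> over its right
  siblings and all their descendants: the nodes of a left-leaning path, read backwards, then form a
  Morley sequence of \<open>p\<close>, and those of a right-veering path one of \<open>q\<close>.

  Such trees of finite height and width are built from the leaves down. Given a tree \<open>S\<close>, choose
  \<open>a\<close> realizing \<open>p\<close> over \<open>MS\<close>. The siblings of the next level are added from right to left: the new
  root \<open>a'\<close> realizes \<open>q\<close> over everything present, so that the roots form a Morley sequence of \<open>q\<close>.
  As \<open>p\<close> is Kim-strict, \<open>S\<close> is Kim-independent from \<open>a\<close>, hence there is \<open>S'\<close> such that \<open>S'a''\<close> has
  the type of \<open>Sa\<close> over \<open>M\<close> for all these roots \<open>a''\<close> at once; \<open>S'\<close> is put above \<open>a'\<close>. Saturation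
  then gives an infinite tree.\<close>

section \<open>Renaming of variables\<close>

lemma finite_fv_tm: "finite (fv_tm t)"
  by (induction t) auto

lemma finite_fv: "finite (fv \<phi>)"
  by (induction \<phi>) (auto simp: finite_fv_tm)

lemma eval_tm_cong: "(\<And>i. i \<in> fv_tm t \<Longrightarrow> e i = e' i) \<Longrightarrow> eval_tm N e t = eval_tm N e' t"
proof (induction t)
  case (Fn f ts)
  then have "map (eval_tm N e) ts = map (eval_tm N e') ts" by auto
  then show ?case by (simp only: eval_tm.simps)
qed simp

lemma sat_cong: "(\<And>i. i \<in> fv \<phi> \<Longrightarrow> e i = e' i) \<Longrightarrow> sat N e \<phi> \<longleftrightarrow> sat N e' \<phi>"
proof (induction \<phi> arbitrary: e e')
  case (Eq t u)
  then show ?case using eval_tm_cong[of t e e' N] eval_tm_cong[of u e e' N] by simp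
next
  case (Rel r ts)
  then have "map (eval_tm N e) ts = map (eval_tm N e') ts" by (auto intro!: eval_tm_cong)
  then show ?case by (simp only: sat.simps)
next
  case (Neg \<phi>)
  show ?case using Neg.IH[of e e', OF Neg.prems] by simp
next
  case (Conj \<phi> \<psi>)
  have "sat N e \<phi> \<longleftrightarrow> sat N e' \<phi>" "sat N e \<psi> \<longleftrightarrow> sat N e' \<psi>"
    by (rule Conj.IH; rule Conj.prems; simp)+
  then show ?case by simp
next
  case (Ex i \<phi>)
  have "sat N (e(i := d)) \<phi> \<longleftrightarrow> sat N (e'(i := d)) \<phi>" for d
    by (rule Ex.IH) (use Ex.prems in auto)
  then show ?case by simp
qed

fun rename_tm :: "(nat \<Rightarrow> nat) \<Rightarrow> 'f tm \<Rightarrow> 'f tm" where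
  "rename_tm g (Var i) = Var (g i)"
| "rename_tm g (Fn f ts) = Fn f (map (rename_tm g) ts)"

definition fresh_var :: "nat set \<Rightarrow> nat" where
  "fresh_var V = Suc (Max (insert 0 V))"

lemma fresh_var_notin: "finite V \<Longrightarrow> fresh_var V \<notin> V"
proof
  assume V: "finite V" and "fresh_var V \<in> V"
  then have "fresh_var V \<le> Max (insert 0 V)" by (intro Max_ge) auto
  then show False by (simp add: fresh_var_def)
qed

text \<open>The map \<open>g\<close> need not be injective, so bound variables are renamed away from its values.\<close>

fun rename :: "(nat \<Rightarrow> nat) \<Rightarrow> ('f, 'r) fm \<Rightarrow> ('f, 'r) fm" where
  "rename g (Eq t u) = Eq (rename_tm g t) (rename_tm g u)"
| "rename g (Rel r ts) = Rel r (map (rename_tm g) ts)"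
| "rename g (Neg p) = Neg (rename g p)"
| "rename g (Conj p q) = Conj (rename g p) (rename g q)"
| "rename g (Ex i p) = (let j = fresh_var (g ` fv p) in Ex j (rename (g(i := j)) p))"

lemma wf_rename_tm: "wf_tm L t \<Longrightarrow> wf_tm L (rename_tm g t)"
  by (induction t) auto

lemma wf_rename: "wf_fm L \<phi> \<Longrightarrow> wf_fm L (rename g \<phi>)"
  by (induction \<phi> arbitrary: g) (auto simp: wf_rename_tm Let_def)

lemma fv_rename_tm: "fv_tm (rename_tm g t) = g ` fv_tm t"
  by (induction t) auto

lemma fv_rename: "fv (rename g \<phi>) = g ` fv \<phi>"
proof (induction \<phi> arbitrary: g)
  case (Ex i \<phi>)
  define j where "j = fresh_var (g ` fv \<phi>)"
  have "j \<notin> g ` fv \<phi>"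
    unfolding j_def by (intro fresh_var_notin finite_imageI finite_fv)
  then have "g(i := j) ` fv \<phi> - {j} = g ` (fv \<phi> - {i})" by auto
  then show ?case by (simp only: rename.simps Let_def fv.simps Ex.IH flip: j_def)
qed (auto simp: fv_rename_tm)

lemma eval_rename_tm: "eval_tm N e (rename_tm g t) = eval_tm N (e \<circ> g) t"
proof (induction t)
  case (Fn f ts)
  then have "map (eval_tm N e) (map (rename_tm g) ts) = map (eval_tm N (e \<circ> g)) ts"
    unfolding map_map by (intro map_cong) (simp_all add: comp_def)
  then show ?case by (simp only: eval_tm.simps rename_tm.simps)
qed simp

lemma sat_rename: "sat N e (rename g \<phi>) \<longleftrightarrow> sat N (e \<circ> g) \<phi>"
proof (induction \<phi> arbitrary: e g)
  case (Rel r ts)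
  have "map (eval_tm N e) (map (rename_tm g) ts) = map (eval_tm N (e \<circ> g)) ts"
    unfolding map_map by (intro map_cong) (simp_all add: eval_rename_tm)
  then show ?case by (simp only: sat.simps rename.simps)
next
  case (Ex i \<phi>)
  define j where "j = fresh_var (g ` fv \<phi>)"
  have j: "j \<notin> g ` fv \<phi>"
    unfolding j_def by (intro fresh_var_notin finite_imageI finite_fv)
  \<comment> \<open>By freshness no free variable other than \<open>i\<close> is sent to
    \<open>j\<close>, so giving \<open>j\<close> the value \<open>d\<close> after the renaming
    amounts, for \<open>\<phi>\<close>, to giving it to \<open>i\<close> before.\<close>
  have "sat N (e(j := d) \<circ> g(i := j)) \<phi> \<longleftrightarrow> sat N ((e \<circ> g)(i := d)) \<phi>" for d
    by (rule sat_cong) (use j in auto)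
  then show ?case by (simp only: rename.simps Let_def sat.simps Ex.IH flip: j_def)
qed (auto simp: eval_rename_tm)

lemma rename_formulas:
  "\<phi> \<in> formulas L k \<Longrightarrow> g ` {..<k} \<subseteq> {..<k'} \<Longrightarrow> rename g \<phi> \<in> formulas L k'"
  by (auto simp: formulas_def wf_rename fv_rename image_subset_iff)

lemma formulas_mono: "\<phi> \<in> formulas L k \<Longrightarrow> k \<le> k' \<Longrightarrow> \<phi> \<in> formulas L k'"
  by (auto simp: formulas_def)

lemma holds_cong:
  "\<phi> \<in> formulas L k \<Longrightarrow> (\<And>i. i < k \<Longrightarrow> e i = w ! i) \<Longrightarrow> sat N e \<phi> \<longleftrightarrow> holds N \<phi> w"
  unfolding holds_def by (rule sat_cong) (auto simp: formulas_def)

lemma holds_rename: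
  assumes "\<phi> \<in> formulas L k" and "\<And>i. i < k \<Longrightarrow> w' ! g i = w ! i"
  shows "holds N (rename g \<phi>) w' \<longleftrightarrow> holds N \<phi> w"
  using holds_cong[OF assms(1), of "\<lambda>i. w' ! g i" w N] assms(2)
  by (simp add: holds_def sat_rename comp_def)

text \<open>Inserting a dummy block \<open>v\<close> brings formulas with different parameter tuples
  to a common longer tuple.\<close>

lemma holds_rename_skip:
  assumes "\<phi> \<in> formulas L (length u + length w)"
  shows "holds N (rename (\<lambda>i. if i < length u then i else i + length v) \<phi>) (u @ v @ w) \<longleftrightarrow>
    holds N \<phi> (u @ w)"
  by (rule holds_rename[OF assms]) (auto simp: nth_append)

lemma length_concat_const: "(\<And>x. x \<in> set xs \<Longrightarrow> length x = m) \<Longrightarrow> length (concat xs) = length xs * m"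
  by (induction xs) auto

lemma Neg_formulas [simp]: "Neg \<phi> \<in> formulas L k \<longleftrightarrow> \<phi> \<in> formulas L k"
  by (simp add: formulas_def)

lemma Conj_formulas [simp]:
  "Conj \<phi> \<psi> \<in> formulas L k \<longleftrightarrow> \<phi> \<in> formulas L k \<and> \<psi> \<in> formulas L k"
  by (auto simp: formulas_def)

lemma holds_Neg [simp]: "holds N (Neg \<phi>) w \<longleftrightarrow> \<not> holds N \<phi> w"
  by (simp add: holds_def)

lemma holds_Conj [simp]: "holds N (Conj \<phi> \<psi>) w \<longleftrightarrow> holds N \<phi> w \<and> holds N \<psi> w"
  by (simp add: holds_def)

text \<open>A sentence, unlike \<open>Eq (Var 0) (Var 0)\<close>, so that it belongs to
  \<open>formulas L k\<close> also for \<open>k = 0\<close>.\<close>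

definition Verum :: "('f, 'r) fm" where
  "Verum = Neg (Ex 0 (Neg (Eq (Var 0) (Var 0))))"

lemma Verum_formulas [simp]: "Verum \<in> formulas L k"
  by (simp add: Verum_def formulas_def)

lemma holds_Verum [simp]: "holds N Verum w"
  by (simp add: Verum_def holds_def)

section \<open>Definability of some conditions on tuples\<close>

lemma ex_conj_fm:
  assumes "finite G" and "\<And>\<gamma>. \<gamma> \<in> G \<Longrightarrow> wf_fm L \<gamma>"
  obtains \<chi> where "wf_fm L \<chi>" "\<And>e. sat N e \<chi> \<longleftrightarrow> (\<forall>\<gamma>\<in>G. sat N e \<gamma>)"
proof -
  have "\<exists>\<chi>. wf_fm L \<chi> \<and> (\<forall>e. sat N e \<chi> \<longleftrightarrow> (\<forall>\<gamma>\<in>G. sat N e \<gamma>))"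
    using assms
  proof (induction G rule: finite_induct)
    case empty
    show ?case by (rule exI[of _ Verum]) (simp add: Verum_def)
  next
    case (insert \<gamma> G)
    then obtain \<chi> where "wf_fm L \<chi>" "\<forall>e. sat N e \<chi> \<longleftrightarrow> (\<forall>\<gamma>\<in>G. sat N e \<gamma>)" by auto
    then show ?case using insert.prems by (intro exI[of _ "Conj \<gamma> \<chi>"]) auto
  qed
  then show thesis using that by blast
qed

text \<open>Each member of \<open>G\<close> has its own parameter tuple. These are concatenated to
  \<open>d\<close>, and variables are renamed so that every conjunct finds its own block.\<close>

lemma ex_conj_pfm:
  assumes "finite G" and "G \<subseteq> pformulas L k A"
  obtains \<theta> d where "(\<theta>, d) \<in> pformulas L k A"
    "\<And>y. length y = k \<Longrightarrow> holds N \<theta> (y @ d) \<longleftrightarrow> (\<forall>(\<psi>, c)\<in>G. holds N \<psi> (y @ c))"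
proof -
  have "\<exists>\<theta> d. (\<theta>, d) \<in> pformulas L k A \<and>
    (\<forall>y. length y = k \<longrightarrow> (holds N \<theta> (y @ d) \<longleftrightarrow> (\<forall>(\<psi>, c)\<in>G. holds N \<psi> (y @ c))))"
    using assms
  proof (induction G rule: finite_induct)
    case empty
    show ?case
      by (rule exI[of _ Verum], rule exI[of _ "[]"]) (simp add: pformulas_def)
  next
    case (insert \<gamma> G)
    obtain \<psi> c where \<gamma>: "\<gamma> = (\<psi>, c)" by (cases \<gamma>)
    then have \<psi>: "\<psi> \<in> formulas L (k + length c)" "c \<in> lists A"
      using insert.prems by (auto simp: pformulas_def)
    obtain \<theta> d where "(\<theta>, d) \<in> pformulas L k A" and
      IH: "\<forall>y. length y = k \<longrightarrow> (holds N \<theta> (y @ d) \<longleftrightarrow> (\<forall>(\<psi>, c)\<in>G. holds N \<psi> (y @ c)))"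
      using insert by auto
    then have \<theta>: "\<theta> \<in> formulas L (k + length d)" "d \<in> lists A"
      by (auto simp: pformulas_def)
    define g where "g = (\<lambda>u. if u < k then u else u + length c)"
    have 1: "rename g \<theta> \<in> formulas L (k + length (c @ d))"
      by (rule rename_formulas[OF \<theta>(1)]) (auto simp: g_def)
    have 2: "\<psi> \<in> formulas L (k + length (c @ d))"
      using \<psi>(1) by (rule formulas_mono) simp
    have 3: "holds N (rename g \<theta>) (y @ c @ d) \<longleftrightarrow> holds N \<theta> (y @ d)" if "length y = k" for y
      using holds_rename_skip[of \<theta> L y d N c] \<theta>(1) that by (simp add: g_def)
    have 4: "holds N \<psi> (y @ c @ d) \<longleftrightarrow> holds N \<psi> (y @ c)" if "length y = k" for y
      unfolding holds_def[of N \<psi> "y @ c @ d"]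
      by (rule holds_cong[OF \<psi>(1)]) (use that in \<open>auto simp: nth_append\<close>)
    have "holds N (Conj \<psi> (rename g \<theta>)) (y @ c @ d) \<longleftrightarrow>
      (\<forall>(\<psi>, c)\<in>insert \<gamma> G. holds N \<psi> (y @ c))" if "length y = k" for y
      using IH[rule_format, OF that] by (simp only: holds_Conj 3[OF that] 4[OF that] \<gamma>) simp
    moreover have "(Conj \<psi> (rename g \<theta>), c @ d) \<in> pformulas L k A"
      using 1 2 \<psi>(2) \<theta>(2) unfolding pformulas_def by simp
    ultimately show ?case by blast
  qed
  then show thesis using that by blast
qed

lemma ex_exists_fm:
  assumes "\<psi> \<in> formulas L (l + k)"
  obtains \<chi> where "\<chi> \<in> formulas L k"
    "\<And>w. length w = k \<Longrightarrow> holds N \<chi> w \<longleftrightarrow> (\<exists>y\<in>tuples N l. holds N \<psi> (y @ w))"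
proof -
  have "\<exists>\<chi>\<in>formulas L k. \<forall>w. length w = k \<longrightarrow>
    (holds N \<chi> w \<longleftrightarrow> (\<exists>y\<in>tuples N l. holds N \<psi> (y @ w)))"
    using assms
  proof (induction l arbitrary: \<psi>)
    case 0
    then show ?case by (intro bexI[of _ \<psi>]) (auto simp: tuples_def)
  next
    case (Suc l)
    \<comment> \<open>The coordinate to be quantified moves behind all others, to index
      \<open>l + k\<close>; the others move down by one, so that the remaining \<open>l\<close>
      variables again stand first.\<close>
    define g where "g = (\<lambda>u. case u of 0 \<Rightarrow> l + k | Suc u \<Rightarrow> u)"
    define \<psi>' where "\<psi>' = Ex (l + k) (rename g \<psi>)"
    have "rename g \<psi> \<in> formulas L (Suc (l + k))"
      by (rule rename_formulas[OF Suc.prems]) (auto simp: g_def split: nat.splits)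
    then have \<psi>': "\<psi>' \<in> formulas L (l + k)"
      by (auto simp: \<psi>'_def formulas_def)
    have *: "holds N \<psi>' v \<longleftrightarrow> (\<exists>d\<in>univ N. holds N \<psi> (d # v))" if "length v = l + k" for v
    proof -
      have "sat N (((!) v)(l + k := d) \<circ> g) \<psi> \<longleftrightarrow> holds N \<psi> (d # v)" for d
        by (rule holds_cong[OF Suc.prems]) (use that in \<open>auto simp: g_def split: nat.splits\<close>)
      then show ?thesis by (simp add: \<psi>'_def holds_def sat_rename)
    qed
    obtain \<chi> where \<chi>: "\<chi> \<in> formulas L k" "\<forall>w. length w = k \<longrightarrow>
      (holds N \<chi> w \<longleftrightarrow> (\<exists>y\<in>tuples N l. holds N \<psi>' (y @ w)))"
      using Suc.IH[OF \<psi>'] by blast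
    have "holds N \<chi> w \<longleftrightarrow> (\<exists>y\<in>tuples N (Suc l). holds N \<psi> (y @ w))" if w: "length w = k" for w
    proof -
      have "(\<exists>y\<in>tuples N (Suc l). holds N \<psi> (y @ w)) \<longleftrightarrow>
        (\<exists>d\<in>univ N. \<exists>y\<in>tuples N l. holds N \<psi> (d # y @ w))"
      proof
        assume "\<exists>y\<in>tuples N (Suc l). holds N \<psi> (y @ w)"
        then obtain y where y: "y \<in> tuples N (Suc l)" "holds N \<psi> (y @ w)" by blast
        then obtain d y' where "y = d # y'" by (cases y) (auto simp: tuples_def)
        then show "\<exists>d\<in>univ N. \<exists>y\<in>tuples N l. holds N \<psi> (d # y @ w)"
          using y by (auto simp: tuples_def)
      next
        assume "\<exists>d\<in>univ N. \<exists>y\<in>tuples N l. holds N \<psi> (d # y @ w)"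
        then obtain d y where "d \<in> univ N" "y \<in> tuples N l" "holds N \<psi> (d # y @ w)" by blast
        then show "\<exists>y\<in>tuples N (Suc l). holds N \<psi> (y @ w)"
          by (intro bexI[of _ "d # y"]) (auto simp: tuples_def)
      qed
      then show ?thesis
        using \<chi>(2) w * by (auto simp: tuples_def)
    qed
    then show ?case using \<chi>(1) by blast
  qed
  then show thesis using that by blast
qed

text \<open>Makes solvability of finitely many instances a property of the type of the concatenated
  tuple; this is how common solutions are carried from one Morley sequence to another.\<close>

lemma ex_common_solution_fm:
  assumes "\<theta> \<in> formulas L (l + m + k)"
  obtains \<chi> where "\<chi> \<in> formulas L (r * m + k)"
    "\<And>xs d. length xs = r \<Longrightarrow> (\<And>x. x \<in> set xs \<Longrightarrow> length x = m) \<Longrightarrow> length d = k \<Longrightarrow>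
       holds N \<chi> (concat xs @ d) \<longleftrightarrow> (\<exists>y\<in>tuples N l. \<forall>x\<in>set xs. holds N \<theta> (y @ x @ d))"
proof -
  \<comment> \<open>The conjunction is built first, with \<open>y\<close> still free, by induction
    on the number of tuples; \<open>y\<close> is quantified afterwards.\<close>
  have "\<exists>\<psi>\<in>formulas L (l + (r * m + k)). \<forall>xs d y. length xs = r \<and> (\<forall>x\<in>set xs. length x = m) \<and>
    length d = k \<and> length y = l \<longrightarrow>
    (holds N \<psi> (y @ concat xs @ d) \<longleftrightarrow> (\<forall>x\<in>set xs. holds N \<theta> (y @ x @ d)))"
  proof (induction r)
    case 0
    show ?case by (rule bexI[of _ Verum]) auto
  next
    case (Suc r)
    then obtain \<psi> where \<psi>: "\<psi> \<in> formulas L (l + (r * m + k))"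
      and IH: "\<And>xs d y. length xs = r \<Longrightarrow> \<forall>x\<in>set xs. length x = m \<Longrightarrow>
        length d = k \<Longrightarrow> length y = l \<Longrightarrow>
        (holds N \<psi> (y @ concat xs @ d) \<longleftrightarrow> (\<forall>x\<in>set xs. holds N \<theta> (y @ x @ d)))"
      by blast
    \<comment> \<open>\<open>f\<close> lets \<open>\<theta>\<close> skip the later tuples,
      \<open>g\<close> lets \<open>\<psi>\<close> skip the first one.\<close>
    define f where "f = (\<lambda>u. if u < l + m then u else u + r * m)"
    define g where "g = (\<lambda>u. if u < l then u else u + m)"
    have f: "rename f \<theta> \<in> formulas L (l + (Suc r * m + k))"
      by (rule rename_formulas[OF assms]) (auto simp: f_def)
    have g: "rename g \<psi> \<in> formulas L (l + (Suc r * m + k))"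
      by (rule rename_formulas[OF \<psi>]) (auto simp: g_def)
    have "holds N (Conj (rename f \<theta>) (rename g \<psi>)) (y @ concat xs @ d) \<longleftrightarrow>
      (\<forall>x\<in>set xs. holds N \<theta> (y @ x @ d))"
      if xs: "length xs = Suc r" "\<forall>x\<in>set xs. length x = m" "length d = k" "length y = l" for xs d y
    proof -
      obtain x xs' where xs_eq: "xs = x # xs'" using xs by (cases xs) auto
      have x: "length x = m" and xs': "length xs' = r" "\<forall>x\<in>set xs'. length x = m"
        using xs by (auto simp: xs_eq)
      have len: "length (concat xs') = r * m"
        using length_concat_const[of xs' m] xs' by simp
      have "holds N (rename f \<theta>) ((y @ x) @ concat xs' @ d) \<longleftrightarrow> holds N \<theta> ((y @ x) @ d)"
        using holds_rename_skip[of \<theta> L "y @ x" d N "concat xs'"] assms xs x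
        by (simp add: f_def len cong: if_cong)
      moreover have "holds N (rename g \<psi>) (y @ x @ concat xs' @ d) \<longleftrightarrow> holds N \<psi> (y @ concat xs' @ d)"
        using holds_rename_skip[of \<psi> L y "concat xs' @ d" N x] \<psi> xs x
        by (simp add: g_def len cong: if_cong)
      ultimately show ?thesis using IH[of xs' d y] xs xs' by (simp add: xs_eq)
    qed
    moreover have "Conj (rename f \<theta>) (rename g \<psi>) \<in> formulas L (l + (Suc r * m + k))"
      using f g by simp
    ultimately show ?case by blast
  qed
  then obtain \<psi> where \<psi>: "\<psi> \<in> formulas L (l + (r * m + k))" and
    *: "\<And>xs d y. length xs = r \<Longrightarrow> \<forall>x\<in>set xs. length x = m \<Longrightarrow> length d = k \<Longrightarrow> length y = l \<Longrightarrow>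
      (holds N \<psi> (y @ concat xs @ d) \<longleftrightarrow> (\<forall>x\<in>set xs. holds N \<theta> (y @ x @ d)))"
    by blast
  obtain \<chi> where \<chi>: "\<chi> \<in> formulas L (r * m + k)"
    "\<And>w. length w = r * m + k \<Longrightarrow> holds N \<chi> w \<longleftrightarrow> (\<exists>y\<in>tuples N l. holds N \<psi> (y @ w))"
    using ex_exists_fm[OF \<psi>] by blast
  show thesis
  proof (rule that[OF \<chi>(1)])
    fix xs :: "'c list list" and d :: "'c list"
    assume xs: "length xs = r" "\<And>x. x \<in> set xs \<Longrightarrow> length x = m" and d: "length d = k"
    have "length (concat xs @ d) = r * m + k"
      using length_concat_const[of xs m] xs d by simp
    then have "holds N \<chi> (concat xs @ d) \<longleftrightarrow> (\<exists>y\<in>tuples N l. holds N \<psi> (y @ concat xs @ d))"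
      by (rule \<chi>(2))
    also have "\<dots> \<longleftrightarrow> (\<exists>y\<in>tuples N l. \<forall>x\<in>set xs. holds N \<theta> (y @ x @ d))"
      by (rule bex_cong[OF refl], rule *) (use xs d in \<open>auto simp: tuples_def\<close>)
    finally show "holds N \<chi> (concat xs @ d) \<longleftrightarrow>
      (\<exists>y\<in>tuples N l. \<forall>x\<in>set xs. holds N \<theta> (y @ x @ d))" .
  qed
qed

section \<open>Types in a monster model\<close>

lemma consistentD: "consistent N n p \<Longrightarrow> finite F \<Longrightarrow> F \<subseteq> p \<Longrightarrow> \<exists>a. realizes N n a F"
  by (simp add: consistent_def)

lemma consistent_mono: "consistent N n p \<Longrightarrow> p' \<subseteq> p \<Longrightarrow> consistent N n p'"
  by (auto simp: consistent_def)

lemma realizes_mono: "realizes N n a p \<Longrightarrow> p' \<subseteq> p \<Longrightarrow> realizes N n a p'"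
  by (auto simp: realizes_def)

lemma realizes_restrict_mono:
  "realizes N n a (restrict_type q A) \<Longrightarrow> B \<subseteq> A \<Longrightarrow> realizes N n a (restrict_type q B)"
  by (erule realizes_mono) (auto simp: restrict_type_def)

section \<open>Consistency, saturation and automorphisms\<close>

locale monster_model =
  fixes \<kappa> :: "'k rel" and L :: "('f, 'r) lang" and N :: "('f, 'r, 'a) struct"
  assumes card_order: "Card_order \<kappa>" and uncountable: "natLeq <o \<kappa>"
    and struct: "is_struct L N"
    and saturated: "saturated \<kappa> L N"
    and homogeneous: "strongly_homogeneous \<kappa> L N"
begin

lemma finite_imp_small: "finite A \<Longrightarrow> small \<kappa> A"
  using uncountable finite_iff_ordLess_natLeq ordLess_transitive unfolding small_def by blast

lemma small_Un:
  assumes "small \<kappa> A" and "small \<kappa> B"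
  shows "small \<kappa> (A \<union> B)"
proof -
  have "infinite (Field \<kappa>)"
  proof
    assume "finite (Field \<kappa>)"
    then have "|Field \<kappa>| <o natLeq" by (simp add: finite_iff_ordLess_natLeq)
    then have "\<kappa> <o natLeq"
      using card_of_Field_ordIso[OF card_order] ordIso_ordLess_trans ordIso_symmetric by blast
    then show False
      using uncountable not_ordLess_ordLeq ordLess_imp_ordLeq by blast
  qed
  then show ?thesis
    using assms card_order card_of_Un_ordLess_infinite_Field unfolding small_def by blast
qed

text \<open>If both extensions fail, finite sets \<open>F\<close> and \<open>G\<close> witness it; a
  realization of their part in \<open>p\<close> satisfies \<open>\<phi>\<close> or its negation, and
  so realizes one of them.\<close>

lemma consistent_insert_or_Neg:
  assumes p: "consistent N n p"
  shows "consistent N n (insert (\<phi>, c) p) \<or> consistent N n (insert (Neg \<phi>, c) p)"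
proof (rule ccontr)
  assume "\<not> ?thesis"
  then obtain F G where F: "finite F" "F \<subseteq> insert (\<phi>, c) p" "\<nexists>a. realizes N n a F"
    and G: "finite G" "G \<subseteq> insert (Neg \<phi>, c) p" "\<nexists>a. realizes N n a G"
    by (auto simp: consistent_def)
  define H where "H = F - {(\<phi>, c)} \<union> (G - {(Neg \<phi>, c)})"
  have "finite H" "H \<subseteq> p" using F G by (auto simp: H_def)
  from consistentD[OF p this] obtain a where a: "realizes N n a H" by (rule exE)
  have "realizes N n a F \<or> realizes N n a G"
  proof (cases "holds N \<phi> (a @ c)")
    case True
    then have "realizes N n a F" using a by (auto simp: realizes_def H_def)
    then show ?thesis ..
  next
    case False
    then have "realizes N n a G" using a by (auto simp: realizes_def H_def)
    then show ?thesis ..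
  qed
  then show False using F G by blast
qed

text \<open>Saturation speaks of complete types. Zorn's lemma gives a maximal consistent extension
  over the same parameters, and maximality makes it complete.\<close>

lemma realize_partial_type:
  assumes \<pi>: "\<pi> \<subseteq> pformulas L n A" "consistent N n \<pi>" and A: "A \<subseteq> univ N" "small \<kappa> A"
  obtains a where "realizes N n a \<pi>"
proof -
  define \<A> where "\<A> = {p. \<pi> \<subseteq> p \<and> p \<subseteq> pformulas L n A \<and> consistent N n p}"
  have "\<exists>p\<in>\<A>. \<forall>X\<in>\<A>. p \<subseteq> X \<longrightarrow> X = p"
  proof (rule subset_Zorn_nonempty)
    show "\<A> \<noteq> {}" using \<pi> by (auto simp: \<A>_def)
    fix \<C> assume \<C>: "\<C> \<noteq> {}" "subset.chain \<A> \<C>"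
    then have sub: "\<C> \<subseteq> \<A>" by (simp add: subset.chain_def)
    have "consistent N n (\<Union>\<C>)"
      unfolding consistent_def
    proof (intro allI impI)
      fix F assume "finite F \<and> F \<subseteq> \<Union>\<C>"
      then obtain p where "p \<in> \<C>" "F \<subseteq> p"
        using finite_subset_Union_chain[of F \<C> \<A>] \<C> by metis
      then show "\<exists>a. realizes N n a F"
        using sub \<open>finite F \<and> F \<subseteq> \<Union>\<C>\<close> consistentD[of N n p F] unfolding \<A>_def by blast
    qed
    then show "\<Union>\<C> \<in> \<A>" using \<C>(1) sub unfolding \<A>_def by blast
  qed
  then obtain p where p: "p \<in> \<A>" and max: "\<And>X. X \<in> \<A> \<Longrightarrow> p \<subseteq> X \<Longrightarrow> X = p" by blast
  have "(\<phi>, c) \<in> p \<or> (Neg \<phi>, c) \<in> p" if "(\<phi>, c) \<in> pformulas L n A" for \<phi> c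
  proof -
    have "(Neg \<phi>, c) \<in> pformulas L n A" using that by (simp add: pformulas_def)
    then have "insert (\<phi>, c) p \<in> \<A> \<or> insert (Neg \<phi>, c) p \<in> \<A>"
      using consistent_insert_or_Neg[of n p \<phi> c] p that unfolding \<A>_def by auto
    then show ?thesis using max by blast
  qed
  then have "p \<in> complete_types L N n A" using p unfolding complete_types_def \<A>_def by auto
  then obtain a where "realizes N n a p" using saturated A unfolding saturated_def by blast
  moreover have "\<pi> \<subseteq> p" using p by (simp add: \<A>_def)
  ultimately show thesis using that realizes_mono by blast
qed

lemma automorphism_eval_tm:
  assumes \<sigma>: "automorphism L N \<sigma>"
  shows "wf_tm L t \<Longrightarrow> e ` fv_tm t \<subseteq> univ N \<Longrightarrow>
    eval_tm N e t \<in> univ N \<and> eval_tm N (\<lambda>i. \<sigma> (e i)) t = \<sigma> (eval_tm N e t)"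
proof (induction t)
  case (Fn f ts)
  have IH: "eval_tm N e t \<in> univ N \<and> eval_tm N (\<lambda>i. \<sigma> (e i)) t = \<sigma> (eval_tm N e t)" if "t \<in> set ts" for t
    using Fn that by (intro Fn.IH) auto
  then have tup: "map (eval_tm N e) ts \<in> tuples N (farity L f)"
    using Fn.prems by (auto simp: tuples_def)
  have "map (eval_tm N (\<lambda>i. \<sigma> (e i))) ts = map \<sigma> (map (eval_tm N e) ts)"
    unfolding map_map by (intro map_cong) (use IH in auto)
  moreover have "fint N f (map (eval_tm N e) ts) \<in> univ N"
    using tup struct Fn.prems unfolding is_struct_def tuples_def by auto
  ultimately show ?case
    using \<sigma> tup Fn.prems unfolding automorphism_def by (auto simp del: map_map)
qed simp

lemma automorphism_sat:
  assumes \<sigma>: "automorphism L N \<sigma>"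
  shows "wf_fm L \<phi> \<Longrightarrow> e ` fv \<phi> \<subseteq> univ N \<Longrightarrow> sat N (\<lambda>i. \<sigma> (e i)) \<phi> \<longleftrightarrow> sat N e \<phi>"
proof (induction \<phi> arbitrary: e)
  case (Eq t u)
  have "inj_on \<sigma> (univ N)" using \<sigma> by (simp add: automorphism_def bij_betw_def)
  moreover have "eval_tm N e t \<in> univ N \<and> eval_tm N (\<lambda>i. \<sigma> (e i)) t = \<sigma> (eval_tm N e t)"
    "eval_tm N e u \<in> univ N \<and> eval_tm N (\<lambda>i. \<sigma> (e i)) u = \<sigma> (eval_tm N e u)"
    using Eq by (intro automorphism_eval_tm[OF \<sigma>]; auto)+
  ultimately show ?case by (auto dest: inj_onD)
next
  case (Rel r ts)
  have *: "eval_tm N e t \<in> univ N \<and> eval_tm N (\<lambda>i. \<sigma> (e i)) t = \<sigma> (eval_tm N e t)" if "t \<in> set ts" for t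
    using Rel that by (intro automorphism_eval_tm[OF \<sigma>]) auto
  then have "map (eval_tm N e) ts \<in> tuples N (rarity L r)"
    using Rel.prems by (auto simp: tuples_def)
  moreover have "map (eval_tm N (\<lambda>i. \<sigma> (e i))) ts = map \<sigma> (map (eval_tm N e) ts)"
    unfolding map_map by (intro map_cong) (use * in auto)
  ultimately show ?case
    using \<sigma> Rel.prems unfolding automorphism_def by (auto simp del: map_map)
next
  case (Ex i \<phi>)
  have img: "\<sigma> ` univ N = univ N" using \<sigma> by (simp add: automorphism_def bij_betw_def)
  have *: "sat N ((\<lambda>i. \<sigma> (e i))(i := \<sigma> d)) \<phi> \<longleftrightarrow> sat N (e(i := d)) \<phi>" if "d \<in> univ N" for d
  proof -
    have "(\<lambda>j. \<sigma> (e j))(i := \<sigma> d) = (\<lambda>j. \<sigma> ((e(i := d)) j))" by auto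
    moreover have "sat N (\<lambda>j. \<sigma> ((e(i := d)) j)) \<phi> \<longleftrightarrow> sat N (e(i := d)) \<phi>"
      using Ex.prems that by (intro Ex.IH) auto
    ultimately show ?thesis by metis
  qed
  \<comment> \<open>\<open>\<sigma>\<close> is onto the universe, so a witness may be taken of the
    form \<open>\<sigma> d\<close>.\<close>
  have "sat N (\<lambda>i. \<sigma> (e i)) (Ex i \<phi>) \<longleftrightarrow> (\<exists>d\<in>\<sigma> ` univ N. sat N ((\<lambda>i. \<sigma> (e i))(i := d)) \<phi>)"
    by (simp only: sat.simps img)
  also have "\<dots> \<longleftrightarrow> sat N e (Ex i \<phi>)" using * by (simp only: bex_simps sat.simps cong: bex_cong)
  finally show ?case .
next
  case (Neg \<phi>)
  show ?case using Neg.IH[of e] Neg.prems by simp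
next
  case (Conj \<phi> \<psi>)
  show ?case using Conj.IH[of e] Conj.prems by (simp add: image_Un)
qed

lemma automorphism_holds:
  assumes \<sigma>: "automorphism L N \<sigma>" and \<phi>: "\<phi> \<in> formulas L (length a)" and a: "a \<in> lists (univ N)"
  shows "holds N \<phi> (map \<sigma> a) \<longleftrightarrow> holds N \<phi> a"
proof -
  have "(!) a ` fv \<phi> \<subseteq> univ N"
    using \<phi> a by (auto simp: formulas_def dest!: subsetD in_listsD[THEN bspec, OF _ nth_mem])
  then have "sat N (\<lambda>i. \<sigma> (a ! i)) \<phi> \<longleftrightarrow> holds N \<phi> a"
    unfolding holds_def using \<phi> by (intro automorphism_sat[OF \<sigma>]) (auto simp: formulas_def)
  moreover have "sat N (\<lambda>i. \<sigma> (a ! i)) \<phi> \<longleftrightarrow> holds N \<phi> (map \<sigma> a)"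
    by (rule holds_cong[OF \<phi>]) simp
  ultimately show ?thesis by simp
qed

lemma automorphism_in_univ: "automorphism L N \<sigma> \<Longrightarrow> x \<in> univ N \<Longrightarrow> \<sigma> x \<in> univ N"
  by (auto simp: automorphism_def bij_betw_def)

end

section \<open>Automorphisms over a small base and invariant types\<close>

locale small_base = monster_model \<kappa> L N
  for \<kappa> :: "'k rel" and L :: "('f, 'r) lang" and N :: "('f, 'r, 'a) struct" +
  fixes M :: "'a set"
  assumes M_sub: "M \<subseteq> univ N" and M_small: "small \<kappa> M"
begin

definition fixing_automorphism :: "('a \<Rightarrow> 'a) \<Rightarrow> bool" where
  "fixing_automorphism \<sigma> \<longleftrightarrow> automorphism L N \<sigma> \<and> (\<forall>d\<in>M. \<sigma> d = d)"

lemma fixing_map: "fixing_automorphism \<sigma> \<Longrightarrow> d \<in> lists M \<Longrightarrow> map \<sigma> d = d"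
  by (induction d) (auto simp: fixing_automorphism_def)

lemma fixing_holds:
  "fixing_automorphism \<sigma> \<Longrightarrow> \<phi> \<in> formulas L (length a) \<Longrightarrow> a \<in> lists (univ N) \<Longrightarrow>
    holds N \<phi> (map \<sigma> a) \<longleftrightarrow> holds N \<phi> a"
  unfolding fixing_automorphism_def using automorphism_holds by blast

lemma fixing_in_univ: "fixing_automorphism \<sigma> \<Longrightarrow> x \<in> univ N \<Longrightarrow> \<sigma> x \<in> univ N"
  unfolding fixing_automorphism_def using automorphism_in_univ by blast

lemma tp_fixing:
  assumes \<sigma>: "fixing_automorphism \<sigma>" and c: "c \<in> lists (univ N)"
  shows "tp L N (map \<sigma> c) M = tp L N c M"
proof -
  have "holds N \<phi> (map \<sigma> c @ d) \<longleftrightarrow> holds N \<phi> (c @ d)"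
    if "d \<in> lists M" "\<phi> \<in> formulas L (length c + length d)" for \<phi> d
    using fixing_holds[OF \<sigma>, of \<phi> "c @ d"] fixing_map[OF \<sigma>, of d] that c M_sub by auto
  then show ?thesis by (auto simp: tp_def pformulas_def)
qed

text \<open>Equality of types makes the map from \<open>u\<close> to \<open>u'\<close>, joined with
  the identity on \<open>M\<close>, elementary; strong homogeneity extends it to an
  automorphism.\<close>

lemma tp_eq_imp_fixing:
  assumes u: "u \<in> lists (univ N)" "u' \<in> lists (univ N)" and len: "length u = length u'"
    and tp: "tp L N u M = tp L N u' M"
  obtains \<sigma> where "fixing_automorphism \<sigma>" "map \<sigma> u = u'"
proof -
  \<comment> \<open>Only a relation at first: \<open>u\<close> may repeat entries or meet
    \<open>M\<close>, so well-definedness has to be shown.\<close>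
  define R where "R x y \<longleftrightarrow> (\<exists>i<length u. x = u ! i \<and> y = u' ! i) \<or> x \<in> M \<and> y = x" for x y
  have elem: "holds N \<phi> a \<longleftrightarrow> holds N \<phi> a'"
    if R: "list_all2 R a a'" and \<phi>: "\<phi> \<in> formulas L (length a)" for \<phi> a a'
  proof -
    obtain d where d: "set d = set a \<inter> M" using finite_list[of "set a \<inter> M"] by auto
    have "\<exists>j<length u + length d. (u @ d) ! j = a ! t \<and> (u' @ d) ! j = a' ! t"
      if t: "t < length a" for t
    proof -
      have "R (a ! t) (a' ! t)" using R t by (rule list_all2_nthD)
      then consider i where "i < length u" "a ! t = u ! i" "a' ! t = u' ! i"
        | "a ! t \<in> M" "a' ! t = a ! t"
        unfolding R_def by blast
      then show ?thesis
      proof cases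
        case 1
        then show ?thesis using len by (intro exI[of _ i]) (auto simp: nth_append)
      next
        case 2
        then have "a ! t \<in> set d" using d t by simp
        then obtain i where "i < length d" "d ! i = a ! t" by (auto simp: in_set_conv_nth)
        then show ?thesis using 2 len by (intro exI[of _ "length u + i"]) (auto simp: nth_append)
      qed
    qed
    \<comment> \<open>\<open>g\<close> finds each entry of \<open>a\<close> in \<open>u @ d\<close>,
      with the matching entry of \<open>a'\<close> at the same place of \<open>u' @ d\<close>;
      renaming along it turns \<open>\<phi>\<close> into a formula about \<open>u\<close> over
      \<open>M\<close>.\<close>
    then obtain g where g: "\<And>t. t < length a \<Longrightarrow> g t < length u + length d"
      "\<And>t. t < length a \<Longrightarrow> (u @ d) ! g t = a ! t" "\<And>t. t < length a \<Longrightarrow> (u' @ d) ! g t = a' ! t"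
      by metis
    have \<psi>: "rename g \<phi> \<in> formulas L (length u + length d)"
      by (rule rename_formulas[OF \<phi>]) (use g(1) in auto)
    have "holds N \<phi> a \<longleftrightarrow> holds N (rename g \<phi>) (u @ d)"
      by (rule holds_rename[OF \<phi>, symmetric]) (rule g(2))
    also have "\<dots> \<longleftrightarrow> (rename g \<phi>, d) \<in> tp L N u M"
      using \<psi> d by (auto simp: tp_def pformulas_def)
    also have "\<dots> \<longleftrightarrow> holds N (rename g \<phi>) (u' @ d)"
      unfolding tp using \<psi> d len by (auto simp: tp_def pformulas_def)
    also have "\<dots> \<longleftrightarrow> holds N \<phi> a'"
      by (rule holds_rename[OF \<phi>]) (rule g(3))
    finally show ?thesis .
  qed
  \<comment> \<open>Elementarity for the formula \<open>Eq (Var 0) (Var 1)\<close> shows that the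
    relation is functional.\<close>
  have fun_R: "y = y'" if "R x y" "R x y'" for x y y'
    using elem[of "[x, x]" "[y, y']" "Eq (Var 0) (Var 1)"] that
    by (simp add: formulas_def holds_def)
  define f where "f x = (SOME y. R x y)" for x
  have f: "f x = y" if "R x y" for x y
    unfolding f_def by (rule some_equality) (use that fun_R in blast)+
  have Rf: "R x (f x)" if "x \<in> M \<union> set u" for x
  proof -
    have "\<exists>y. R x y" using that by (auto simp: R_def in_set_conv_nth)
    then show ?thesis using f by blast
  qed
  have "elementary_map L N (M \<union> set u) f"
    unfolding elementary_map_def
  proof (intro conjI ballI)
    show "f ` (M \<union> set u) \<subseteq> univ N"
    proof
      fix y assume "y \<in> f ` (M \<union> set u)"
      then obtain x where "R x y" using Rf by blast
      then show "y \<in> univ N" using M_sub u(2) len unfolding R_def by auto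
    qed
    fix a \<phi> assume "a \<in> lists (M \<union> set u)" "\<phi> \<in> formulas L (length a)"
    then show "holds N \<phi> a \<longleftrightarrow> holds N \<phi> (map f a)"
      by (intro elem) (auto simp: list_all2_conv_all_nth intro!: Rf dest: nth_mem)
  qed
  moreover have "M \<union> set u \<subseteq> univ N" using M_sub u by auto
  moreover have "small \<kappa> (M \<union> set u)" by (intro small_Un M_small finite_imp_small) simp
  ultimately obtain \<sigma> where \<sigma>: "automorphism L N \<sigma>" "\<forall>a\<in>M \<union> set u. \<sigma> a = f a"
    using homogeneous unfolding strongly_homogeneous_def by blast
  have "f d = d" if "d \<in> M" for d using that by (intro f) (simp add: R_def)
  then have "fixing_automorphism \<sigma>" using \<sigma> by (simp add: fixing_automorphism_def)
  moreover have "map \<sigma> u = u'"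
  proof (rule nth_equalityI)
    show "length (map \<sigma> u) = length u'" using len by simp
    fix i assume "i < length (map \<sigma> u)"
    then have "i < length u" by simp
    moreover from this have "f (u ! i) = u' ! i" by (intro f) (auto simp: R_def)
    ultimately show "map \<sigma> u ! i = u' ! i" using \<sigma>(2) by simp
  qed
  ultimately show thesis using that by blast
qed

lemma realize_invariant:
  assumes q: "invariant_type L N M n q" and B: "B \<subseteq> univ N" "finite B"
  obtains a where "realizes N n a (restrict_type q (M \<union> B))"
proof (rule realize_partial_type)
  show "restrict_type q (M \<union> B) \<subseteq> pformulas L n (M \<union> B)"
    using q by (auto simp: restrict_type_def invariant_type_def complete_types_def pformulas_def)
  have "restrict_type q (M \<union> B) \<subseteq> q" by (auto simp: restrict_type_def)
  then show "consistent N n (restrict_type q (M \<union> B))"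
    using q consistent_mono unfolding invariant_type_def complete_types_def by blast
  show "M \<union> B \<subseteq> univ N" using M_sub B by auto
  show "small \<kappa> (M \<union> B)" using B by (intro small_Un M_small finite_imp_small)
qed (use that in blast)

text \<open>\<open>q\<close> is complete and \<open>a\<close> realizes all of it over
  \<open>M \<union> B\<close>, so a formula true of \<open>a\<close> cannot have its negation in
  \<open>q\<close>.\<close>

lemma invariant_iff_holds:
  assumes q: "invariant_type L N M n q" and a: "realizes N n a (restrict_type q (M \<union> B))"
    and B: "B \<subseteq> univ N" and c: "c \<in> lists (M \<union> B)" and \<psi>: "\<psi> \<in> formulas L (n + length c)"
  shows "(\<psi>, c) \<in> q \<longleftrightarrow> holds N \<psi> (a @ c)"
proof -
  have "holds N \<chi> (a @ c)" if "(\<chi>, c) \<in> q" for \<chi>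
    using a c that by (auto simp: realizes_def restrict_type_def)
  moreover have "(\<psi>, c) \<in> pformulas L n (univ N)"
    using c \<psi> B M_sub by (auto simp: pformulas_def)
  then have "(\<psi>, c) \<in> q \<or> (Neg \<psi>, c) \<in> q"
    using q unfolding invariant_type_def complete_types_def by blast
  ultimately show ?thesis by fastforce
qed

lemma invariantD:
  assumes "invariant_type L N M n q" "(\<phi>, c) \<in> q" "c' \<in> lists (univ N)" "length c' = length c"
    "tp L N c M = tp L N c' M"
  shows "(\<phi>, c') \<in> q"
proof -
  have "(\<phi>, c) \<in> pformulas L n (univ N)"
    using assms(1,2) unfolding invariant_type_def complete_types_def by blast
  then have "\<phi> \<in> formulas L (n + length c)" "c \<in> tuples N (length c)" "c' \<in> tuples N (length c)"
    using assms(3,4) by (auto simp: pformulas_def tuples_def)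
  then show ?thesis using assms(1,2,5) unfolding invariant_type_def by blast
qed

text \<open>Automorphisms over \<open>M\<close> preserve the type of a parameter tuple over
  \<open>M\<close>, hence fix every \<open>M\<close>-invariant type and carry its realizations to
  realizations.\<close>

lemma realizes_fixing:
  assumes q: "invariant_type L N M n q" and a: "realizes N n a (restrict_type q (M \<union> B))"
    and B: "B \<subseteq> univ N" and \<sigma>: "fixing_automorphism \<sigma>"
  shows "realizes N n (map \<sigma> a) (restrict_type q (M \<union> \<sigma> ` B))"
proof -
  have a_tup: "a \<in> lists (univ N)" "length a = n" using a by (auto simp: realizes_def tuples_def)
  have "holds N \<psi> (map \<sigma> a @ c)" if "(\<psi>, c) \<in> q" "c \<in> lists (M \<union> \<sigma> ` B)" for \<psi> c
  proof -
    have "M \<union> \<sigma> ` B = \<sigma> ` (M \<union> B)" using \<sigma> unfolding fixing_automorphism_def by force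
    then obtain c0 where c0: "c0 \<in> lists (M \<union> B)" "c = map \<sigma> c0"
      using \<open>c \<in> lists (M \<union> \<sigma> ` B)\<close> by (metis imageE lists_image)
    then have c0_univ: "c0 \<in> lists (univ N)" using B M_sub by auto
    have "(\<psi>, c0) \<in> q"
      using invariantD[OF q that(1) c0_univ] tp_fixing[OF \<sigma> c0_univ] c0 by simp
    moreover from this have "\<psi> \<in> formulas L (n + length c0)"
      using q by (auto simp: invariant_type_def complete_types_def pformulas_def)
    ultimately have "holds N \<psi> (a @ c0)" using invariant_iff_holds[OF q a B c0(1)] by blast
    then show ?thesis
      using fixing_holds[OF \<sigma>, of \<psi> "a @ c0"] \<open>\<psi> \<in> formulas L (n + length c0)\<close> a_tup c0 c0_univ by simp
  qed
  moreover have "map \<sigma> a \<in> tuples N n"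
    using a_tup fixing_in_univ[OF \<sigma>] by (auto simp: tuples_def)
  ultimately show ?thesis by (auto simp: realizes_def restrict_type_def)
qed

end

section \<open>Compactness in countably many variables\<close>

context monster_model
begin

text \<open>Saturation realizes types of finite tuples, so the assignment is built one value at a
  time, keeping each finite part of \<open>\<Gamma>\<close> solvable by an assignment that starts
  with the values chosen. For each finite part the admissible next values are definable over these,
  and saturation finds one value that serves all parts.\<close>

lemma countable_compactness:
  assumes wf: "\<And>\<gamma>. \<gamma> \<in> \<Gamma> \<Longrightarrow> wf_fm L \<gamma>"
    and fin: "\<And>F. finite F \<Longrightarrow> F \<subseteq> \<Gamma> \<Longrightarrow> \<exists>e. range e \<subseteq> univ N \<and> (\<forall>\<gamma>\<in>F. sat N e \<gamma>)"
  obtains e where "range e \<subseteq> univ N" "\<And>\<gamma>. \<gamma> \<in> \<Gamma> \<Longrightarrow> sat N e \<gamma>"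
proof -
  define ok where
    "ok a F \<longleftrightarrow> (\<exists>e. range e \<subseteq> univ N \<and> map e [0..<length a] = a \<and> (\<forall>\<gamma>\<in>F. sat N e \<gamma>))" for a F
  define good where "good a \<longleftrightarrow> a \<in> lists (univ N) \<and> (\<forall>F. finite F \<longrightarrow> F \<subseteq> \<Gamma> \<longrightarrow> ok a F)" for a
  have ok_mono: "ok a F" if "ok a F'" "F \<subseteq> F'" for a F F'
    using that unfolding ok_def by blast
  have ok_definable: "\<exists>\<theta>\<in>formulas L (1 + length a). \<forall>d\<in>univ N. holds N \<theta> ([d] @ a) \<longleftrightarrow> ok (a @ [d]) F"
    if F: "finite F" "F \<subseteq> \<Gamma>" and a: "a \<in> lists (univ N)" for a F
  proof -
    define i where "i = length a"
    obtain \<chi> where \<chi>: "wf_fm L \<chi>" "\<And>e. sat N e \<chi> \<longleftrightarrow> (\<forall>\<gamma>\<in>F. sat N e \<gamma>)"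
      using ex_conj_fm[of F L N] F wf by blast
    obtain t where "\<forall>v\<in>fv \<chi>. v \<le> t"
      using finite_fv[of \<chi>] by (auto simp: finite_nat_set_iff_bounded_le)
    then have \<chi>': "\<chi> \<in> formulas L (i + 1 + t)"
      using \<chi>(1) by (auto simp: formulas_def)
    \<comment> \<open>\<open>\<chi>\<close> speaks about \<open>a @ [d] @ y\<close> with
      \<open>y\<close> of length \<open>t\<close>; \<open>g\<close> rotates this to
      \<open>y @ [d] @ a\<close>, so that the variables to be quantified come first and
      \<open>a\<close> stands last, as the parameter.\<close>
    define g where "g u = (if u < i then t + 1 + u else if u = i then t else u - i - 1)" for u
    have "rename g \<chi> \<in> formulas L (t + (1 + i))"
      by (rule rename_formulas[OF \<chi>']) (auto simp: g_def)
    then obtain \<theta> where \<theta>: "\<theta> \<in> formulas L (1 + i)"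
      "\<And>w. length w = 1 + i \<Longrightarrow> holds N \<theta> w \<longleftrightarrow> (\<exists>y\<in>tuples N t. holds N (rename g \<chi>) (y @ w))"
      using ex_exists_fm[of "rename g \<chi>" L t "1 + i" N] by blast
    have perm: "holds N (rename g \<chi>) (y @ [d] @ a) \<longleftrightarrow> holds N \<chi> (a @ [d] @ y)"
      if "length y = t" for y d
      by (rule holds_rename[OF \<chi>'])
         (use that in \<open>auto simp: g_def nth_append nth_Cons' i_def\<close>)
    have "holds N \<theta> ([d] @ a) \<longleftrightarrow> ok (a @ [d]) F" if d: "d \<in> univ N" for d
    proof
      assume "holds N \<theta> ([d] @ a)"
      then obtain y where y: "y \<in> tuples N t" "holds N \<chi> (a @ [d] @ y)"
        using \<theta>(2)[of "[d] @ a"] perm by (auto simp: i_def tuples_def)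
      then have len: "length y = t" by (simp add: tuples_def)
      \<comment> \<open>Variables beyond those of \<open>\<chi>\<close> receive the value
        \<open>d\<close>, an arbitrary choice.\<close>
      define e where "e u = (if u < i + 1 + t then (a @ [d] @ y) ! u else d)" for u
      have "(a @ [d] @ y) ! u \<in> univ N" if "u < i + 1 + t" for u
      proof -
        have "(a @ [d] @ y) ! u \<in> set (a @ [d] @ y)" using that len by (intro nth_mem) (simp add: i_def)
        then show ?thesis using a d y by (auto simp: tuples_def)
      qed
      then have "range e \<subseteq> univ N" using d by (auto simp: e_def)
      moreover have "map e [0..<length (a @ [d])] = a @ [d]"
        by (rule nth_equalityI) (auto simp: e_def i_def nth_append simp del: upt_Suc)
      moreover have "sat N e \<chi> \<longleftrightarrow> holds N \<chi> (a @ [d] @ y)"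
        by (rule holds_cong[OF \<chi>']) (simp add: e_def)
      ultimately show "ok (a @ [d]) F" using y \<chi>(2) unfolding ok_def by blast
    next
      assume "ok (a @ [d]) F"
      then obtain e where e: "range e \<subseteq> univ N" "map e [0..<Suc i] = a @ [d]" "sat N e \<chi>"
        unfolding ok_def \<chi>(2) by (auto simp: i_def simp del: upt_Suc)
      define y where "y = map e [i + 1..<i + 1 + t]"
      have "map e [0..<Suc i + t] = map e [0..<Suc i] @ y"
        using upt_add_eq_append[of 0 "Suc i" t] by (simp add: y_def del: upt_Suc)
      then have eq: "a @ [d] @ y = map e [0..<Suc i + t]" using e(2) by simp
      have "sat N e \<chi> \<longleftrightarrow> holds N \<chi> (a @ [d] @ y)"
        unfolding eq by (rule holds_cong[OF \<chi>']) (simp del: upt_Suc)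
      moreover have "y \<in> tuples N t" using range_subsetD[OF e(1)] by (auto simp: y_def tuples_def)
      ultimately show "holds N \<theta> ([d] @ a)"
        using e(3) perm[of y d] \<theta>(2)[of "[d] @ a"] by (auto simp: tuples_def i_def)
    qed
    then show ?thesis using \<theta>(1) unfolding i_def by blast
  qed
  have step: "\<exists>d. good (a @ [d])" if good: "good a" for a
  proof -
    have a: "a \<in> lists (univ N)" using good by (simp add: good_def)
    define def where "def \<theta> F \<longleftrightarrow> finite F \<and> F \<subseteq> \<Gamma> \<and>
      (\<forall>d\<in>univ N. holds N \<theta> ([d] @ a) \<longleftrightarrow> ok (a @ [d]) F)" for \<theta> F
    \<comment> \<open>The formulas that define the admissible next values, for all finite parts of
      \<open>\<Gamma>\<close> together.\<close>
    define \<pi> where "\<pi> = {(\<theta>, c). c = a \<and> \<theta> \<in> formulas L (1 + length a) \<and> (\<exists>F. def \<theta> F)}"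
    obtain x where x: "realizes N 1 x \<pi>"
    proof (rule realize_partial_type)
      show "\<pi> \<subseteq> pformulas L 1 (set a)" by (auto simp: \<pi>_def pformulas_def)
      show "set a \<subseteq> univ N" using a by auto
      show "small \<kappa> (set a)" by (rule finite_imp_small) simp
      show "consistent N 1 \<pi>"
        unfolding consistent_def
      proof (intro allI impI)
        fix G assume G: "finite G \<and> G \<subseteq> \<pi>"
        have "\<forall>z\<in>G. \<exists>F. def (fst z) F" using G by (auto simp: \<pi>_def)
        then obtain Fs where Fs: "\<And>z. z \<in> G \<Longrightarrow> def (fst z) (Fs z)" by metis
        \<comment> \<open>Finitely many such formulas concern a single finite part \<open>U\<close>;
          an assignment for \<open>U\<close> that starts with \<open>a\<close> supplies the next
          value.\<close>
        define U where "U = (\<Union>z\<in>G. Fs z)"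
        have "finite U" "U \<subseteq> \<Gamma>" using G Fs by (auto simp: U_def def_def)
        then have "ok a U" using good by (simp add: good_def)
        then obtain e where e: "range e \<subseteq> univ N" "map e [0..<length a] = a" "\<forall>\<gamma>\<in>U. sat N e \<gamma>"
          unfolding ok_def by (elim exE conjE)
        define d where "d = e (length a)"
        have d: "d \<in> univ N" using e(1) by (auto simp: d_def)
        have "ok (a @ [d]) U"
          unfolding ok_def using e by (intro exI[of _ e]) (simp add: d_def)
        then have "ok (a @ [d]) (Fs z)" if "z \<in> G" for z
          by (rule ok_mono) (use that in \<open>auto simp: U_def\<close>)
        then have "holds N (fst z) ([d] @ a)" if "z \<in> G" for z
          using Fs[OF that] d that unfolding def_def by blast
        then have "realizes N 1 [d] G"
          using G d by (fastforce simp: realizes_def tuples_def \<pi>_def)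
        then show "\<exists>x. realizes N 1 x G" ..
      qed
    qed
    then obtain d where d: "x = [d]" "d \<in> univ N"
      by (cases x) (auto simp: realizes_def tuples_def)
    have "ok (a @ [d]) F" if F: "finite F" "F \<subseteq> \<Gamma>" for F
    proof -
      obtain \<theta> where \<theta>: "\<theta> \<in> formulas L (1 + length a)" "def \<theta> F"
        using ok_definable[OF F a] F unfolding def_def by blast
      then have "(\<theta>, a) \<in> \<pi>" by (auto simp: \<pi>_def)
      then have "holds N \<theta> ([d] @ a)" using x d unfolding realizes_def by blast
      then show ?thesis using \<theta>(2) d unfolding def_def by blast
    qed
    then have "good (a @ [d])" using a d by (simp add: good_def)
    then show ?thesis ..
  qed
  have "\<exists>f. \<forall>i. good (f i) \<and> length (f i) = i \<and> (\<exists>d. f (Suc i) = f i @ [d])"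
  proof -
    have "\<exists>f. \<forall>i. (good (f i) \<and> length (f i) = i) \<and> (\<exists>d. f (Suc i) = f i @ [d])"
    proof (rule dependent_nat_choice)
      have "good []" using fin by (auto simp: good_def ok_def)
      then show "\<exists>a. good a \<and> length a = 0" by auto
      fix a :: "'a list" and i
      assume "good a \<and> length a = i"
      then show "\<exists>b. (good b \<and> length b = Suc i) \<and> (\<exists>d. b = a @ [d])"
        using step[of a] by auto
    qed
    then show ?thesis by blast
  qed
  then obtain f where f: "\<And>i. good (f i)" "\<And>i. length (f i) = i" "\<And>i. \<exists>d. f (Suc i) = f i @ [d]"
    by blast
  define e where "e i = last (f (Suc i))" for i
  have f_eq: "f i = map e [0..<i]" for i
  proof (induction i)
    case 0
    show ?case using f(2)[of 0] by simp
  next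
    case (Suc i)
    obtain d where "f (Suc i) = f i @ [d]" using f(3) by blast
    then show ?case using Suc by (simp add: e_def)
  qed
  show thesis
  proof
    show "range e \<subseteq> univ N"
    proof
      fix x assume "x \<in> range e"
      then obtain i where "x = e i" by blast
      then have "x \<in> set (f (Suc i))" by (simp add: f_eq)
      then show "x \<in> univ N" using f(1)[of "Suc i"] by (auto simp: good_def)
    qed
    fix \<gamma> assume \<gamma>: "\<gamma> \<in> \<Gamma>"
    obtain i where i: "fv \<gamma> \<subseteq> {..<i}"
      using finite_fv[of \<gamma>] by (auto simp: finite_nat_set_iff_bounded)
    \<comment> \<open>\<open>\<gamma>\<close> sees only the first \<open>i\<close> variables, on
      which \<open>e\<close> agrees with an assignment satisfying it.\<close>
    have "ok (f i) {\<gamma>}" using f(1)[of i] \<gamma> by (simp add: good_def)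
    then obtain e' where e': "map e' [0..<i] = map e [0..<i]" "sat N e' \<gamma>"
      unfolding ok_def f_eq by auto
    have "sat N e \<gamma> \<longleftrightarrow> sat N e' \<gamma>"
      by (rule sat_cong) (use e'(1) i in auto)
    then show "sat N e \<gamma>" using e'(2) by simp
  qed
qed

end

section \<open>Morley sequences and Kim-independence\<close>

lemma kim_divides_imp_kim_forks:
  "kim_divides L N M n \<phi> b \<Longrightarrow> (\<phi>, b) \<in> pformulas L n (univ N) \<Longrightarrow> kim_forks L N M n \<phi> b"
  unfolding kim_forks_def by (rule exI[of _ "{(\<phi>, b)}"]) simp

text \<open>Types of tuples are complete: a formula missing from the smaller one would have its
  negation in both.\<close>

lemma tp_eqI_subset:
  assumes sub: "tp L N u A \<subseteq> tp L N v A" and len: "length u = length v"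
  shows "tp L N u A = tp L N v A"
proof (rule antisym[OF sub], rule subrelI)
  fix \<phi> c assume *: "(\<phi>, c) \<in> tp L N v A"
  show "(\<phi>, c) \<in> tp L N u A"
  proof (rule ccontr)
    assume "(\<phi>, c) \<notin> tp L N u A"
    then have "(Neg \<phi>, c) \<in> tp L N u A" using * len by (auto simp: tp_def pformulas_def)
    then have "(Neg \<phi>, c) \<in> tp L N v A" using sub by blast
    then show False using * by (simp add: tp_def)
  qed
qed

lemma tp_append_base:
  assumes tp: "tp L N u A = tp L N v A" and len: "length u = length v" and d: "d \<in> lists A"
  shows "tp L N (u @ d) A = tp L N (v @ d) A"
proof (rule tp_eqI_subset, rule subrelI)
  fix \<phi> c assume "(\<phi>, c) \<in> tp L N (u @ d) A"
  then have "(\<phi>, d @ c) \<in> tp L N u A" using d by (auto simp: tp_def pformulas_def add.assoc)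
  then have "(\<phi>, d @ c) \<in> tp L N v A" using tp by simp
  then show "(\<phi>, c) \<in> tp L N (v @ d) A" by (auto simp: tp_def pformulas_def add.assoc)
qed (use len in simp)

section \<open>Finite Morley sequences and simultaneous conjugation\<close>

context small_base
begin

text \<open>Finite Morley sequences are listed with the last realization first, so that the
  concatenation puts the variables of a type before its parameters.\<close>

fun rev_morley :: "nat \<Rightarrow> ('f, 'r, 'a) pfm set \<Rightarrow> 'a list list \<Rightarrow> bool" where
  "rev_morley n q [] \<longleftrightarrow> True"
| "rev_morley n q (x # xs) \<longleftrightarrow>
     realizes N n x (restrict_type q (M \<union> set (concat xs))) \<and> rev_morley n q xs"

lemma rev_morley_tuples: "rev_morley n q xs \<Longrightarrow> x \<in> set xs \<Longrightarrow> x \<in> tuples N n"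
  by (induction xs) (auto simp: realizes_def)

lemma rev_morley_concat:
  assumes "rev_morley n q xs"
  shows "concat xs \<in> lists (univ N)" "length (concat xs) = length xs * n"
proof -
  have *: "set x \<subseteq> univ N \<and> length x = n" if "x \<in> set xs" for x
    using rev_morley_tuples[OF assms that] by (auto simp: tuples_def)
  show "length (concat xs) = length xs * n"
    by (rule length_concat_const) (use * in blast)
  show "concat xs \<in> lists (univ N)"
    using * unfolding in_lists_conv_set set_concat by blast
qed

text \<open>Meant for paths in trees: there a node realizes the type over the nodes that come later,
  so increasing order of index puts the last realization first.\<close>

lemma rev_morley_map:
  assumes "sorted_wrt (<) ts"
    and "\<And>t. t \<in> set ts \<Longrightarrow>
      realizes N n (f t) (restrict_type q (M \<union> (\<Union>t'\<in>{t' \<in> set ts. t < t'}. set (f t'))))"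
  shows "rev_morley n q (map f (ts :: nat list))"
  using assms
proof (induction ts)
  case (Cons t ts)
  have "realizes N n (f t) (restrict_type q (M \<union> set (concat (map f ts))))"
    by (rule realizes_restrict_mono[OF Cons.prems(2)]) (use Cons.prems(1) in auto)
  moreover have "rev_morley n q (map f ts)"
  proof (rule Cons.IH)
    fix s assume "s \<in> set ts"
    then show "realizes N n (f s) (restrict_type q (M \<union> (\<Union>t'\<in>{t' \<in> set ts. s < t'}. set (f t'))))"
      by (intro realizes_restrict_mono[OF Cons.prems(2)]) auto
  qed (use Cons.prems(1) in simp)
  ultimately show ?case by simp
qed simp

lemma rev_morley_of_morley_seq:
  assumes "morley_seq N M n q b"
  shows "rev_morley n q (rev (map b [0..<r]))"
proof (induction r)
  case (Suc r)
  have "set (concat (rev (map b [0..<r]))) = (\<Union>j<r. set (b j))" by auto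
  then show ?case using Suc assms by (simp add: morley_seq_def)
qed simp

text \<open>By induction: a formula holds of the head over the tail \<open>xs\<close> iff
  \<open>q\<close> contains it with the parameters \<open>concat xs @ d\<close>, and by invariance
  this depends only on the type of these parameters over \<open>M\<close>.\<close>

lemma rev_morley_tp:
  assumes q: "invariant_type L N M n q"
    and "rev_morley n q xs" "rev_morley n q ys" "length xs = length ys"
  shows "tp L N (concat xs) M = tp L N (concat ys) M"
  using assms(4,2,3)
proof (induction xs ys rule: list_induct2)
  case (Cons x xs y ys)
  have xs: "realizes N n x (restrict_type q (M \<union> set (concat xs)))" "rev_morley n q xs"
    and ys: "realizes N n y (restrict_type q (M \<union> set (concat ys)))" "rev_morley n q ys"
    using Cons.prems by auto
  have len: "length (concat xs) = length (concat ys)"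
    using rev_morley_concat(2)[OF xs(2)] rev_morley_concat(2)[OF ys(2)] Cons.hyps by simp
  have lenx: "length x = n" "length y = n" using xs ys by (auto simp: realizes_def tuples_def)
  have IH: "tp L N (concat xs) M = tp L N (concat ys) M" using Cons.IH xs ys by blast
  show ?case
  proof (rule tp_eqI_subset, rule subrelI)
    fix \<phi> d assume "(\<phi>, d) \<in> tp L N (concat (x # xs)) M"
    then have d: "d \<in> lists M" and \<phi>: "\<phi> \<in> formulas L (n + length (concat xs @ d))"
      and h: "holds N \<phi> (x @ concat xs @ d)"
      using lenx by (auto simp: tp_def pformulas_def add.assoc)
    have "set (concat xs) \<subseteq> univ N" "concat xs @ d \<in> lists (M \<union> set (concat xs))"
      using rev_morley_concat(1)[OF xs(2)] d by auto
    then have "(\<phi>, concat xs @ d) \<in> q"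
      using invariant_iff_holds[OF q xs(1) _ _ \<phi>] h by blast
    then have "(\<phi>, concat ys @ d) \<in> q"
      by (rule invariantD[OF q])
         (use rev_morley_concat(1)[OF ys(2)] d M_sub len tp_append_base[OF IH len d] in auto)
    then have "(\<phi>, concat ys @ d) \<in> restrict_type q (M \<union> set (concat ys))"
      using d by (auto simp: restrict_type_def)
    then have "holds N \<phi> (y @ concat ys @ d)"
      using ys(1) by (auto simp: realizes_def)
    then show "(\<phi>, d) \<in> tp L N (concat (y # ys)) M"
      using d \<phi> len lenx by (auto simp: tp_def pformulas_def add.assoc)
  qed (use len lenx in simp)
qed simp

text \<open>Having a common solution is expressed by a formula about the concatenated sequence,
  whose type over \<open>M\<close> is determined by \<open>q\<close> and the length.\<close>

lemma rev_morley_common_solution: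
  assumes q: "invariant_type L N M n q"
    and xs: "rev_morley n q xs" and ys: "rev_morley n q ys" and len: "length xs = length ys"
    and \<theta>: "\<theta> \<in> formulas L (l + n + length d)" and d: "d \<in> lists M"
    and sol: "\<exists>y\<in>tuples N l. \<forall>x\<in>set xs. holds N \<theta> (y @ x @ d)"
  shows "\<exists>y\<in>tuples N l. \<forall>x\<in>set ys. holds N \<theta> (y @ x @ d)"
proof -
  obtain \<chi> where \<chi>: "\<chi> \<in> formulas L (length xs * n + length d)"
    and iff: "\<And>xs' d'. length xs' = length xs \<Longrightarrow> (\<And>x. x \<in> set xs' \<Longrightarrow> length x = n) \<Longrightarrow>
      length d' = length d \<Longrightarrow>
      holds N \<chi> (concat xs' @ d') \<longleftrightarrow> (\<exists>y\<in>tuples N l. \<forall>x\<in>set xs'. holds N \<theta> (y @ x @ d'))"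
    using ex_common_solution_fm[OF \<theta>, of "length xs" N] by blast
  have 1: "length x = n" if "x \<in> set xs" for x
    using rev_morley_tuples[OF xs that] by (simp add: tuples_def)
  have 2: "length x = n" if "x \<in> set ys" for x
    using rev_morley_tuples[OF ys that] by (simp add: tuples_def)
  have "holds N \<chi> (concat xs @ d)" using iff[OF refl 1 refl] sol by simp
  then have "(\<chi>, d) \<in> tp L N (concat xs) M"
    using \<chi> d rev_morley_concat(2)[OF xs] by (simp add: tp_def pformulas_def)
  then have "holds N \<chi> (concat ys @ d)"
    unfolding rev_morley_tp[OF q xs ys len] by (simp add: tp_def)
  then show ?thesis using iff[OF len[symmetric] 2 refl] by simp
qed

text \<open>The initial segment of \<open>b\<close> as long as \<open>xs\<close> has a common
  solution, which passes to \<open>xs\<close>. The tuple \<open>d\<close> is carried along because a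
  formula of a type over \<open>Ma\<close> may use parameters from \<open>M\<close>.\<close>

lemma consistent_imp_common_solution:
  assumes q: "invariant_type L N M n q" and b: "morley_seq N M n q b" and xs: "rev_morley n q xs"
    and \<theta>: "\<theta> \<in> formulas L (l + n + length d)" and d: "d \<in> lists M"
    and con: "consistent N l (range (\<lambda>i. (\<theta>, b i @ d)))"
  shows "\<exists>y\<in>tuples N l. \<forall>x\<in>set xs. holds N \<theta> (y @ x @ d)"
proof (rule rev_morley_common_solution[OF q rev_morley_of_morley_seq[OF b] xs _ \<theta> d])
  show "length (rev (map b [0..<length xs])) = length xs" by simp
  have "\<exists>y. realizes N l y ((\<lambda>i. (\<theta>, b i @ d)) ` {0..<length xs})"
    by (rule consistentD[OF con]) auto
  then show "\<exists>y\<in>tuples N l. \<forall>x\<in>set (rev (map b [0..<length xs])). holds N \<theta> (y @ x @ d)"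
    by (auto simp: realizes_def)
qed

text \<open>This is the type of \<open>y @ d\<close> for \<open>y\<close> realizing
  \<open>q\<close>: the last \<open>length d\<close> variables take the value \<open>d\<close>,
  hence move to the front of the parameters.\<close>

lemma invariant_type_adjoin_base:
  assumes q: "invariant_type L N M n q" and d: "d \<in> lists M"
  shows "invariant_type L N M (n + length d) {(\<psi>, c). (\<psi>, d @ c) \<in> q}"
proof -
  define q' where "q' = {(\<psi>, c). (\<psi>, d @ c) \<in> q}"
  have q_sub: "q \<subseteq> pformulas L n (univ N)" and q_con: "consistent N n q"
    and q_complete: "\<And>\<phi> c. (\<phi>, c) \<in> pformulas L n (univ N) \<Longrightarrow> (\<phi>, c) \<in> q \<or> (Neg \<phi>, c) \<in> q"
    using q unfolding invariant_type_def complete_types_def by auto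
  have d_univ: "d \<in> lists (univ N)" using d M_sub by auto
  have "q' \<subseteq> pformulas L (n + length d) (univ N)"
    using q_sub by (auto simp: q'_def pformulas_def add.assoc)
  moreover have "consistent N (n + length d) q'"
    unfolding consistent_def
  proof (intro allI impI)
    fix F assume F: "finite F \<and> F \<subseteq> q'"
    have "\<exists>y. realizes N n y ((\<lambda>(\<psi>, c). (\<psi>, d @ c)) ` F)"
      by (rule consistentD[OF q_con]) (use F in \<open>auto simp: q'_def\<close>)
    then obtain y where "realizes N n y ((\<lambda>(\<psi>, c). (\<psi>, d @ c)) ` F)" ..
    then have "realizes N (n + length d) (y @ d) F"
      using d_univ by (fastforce simp: realizes_def tuples_def)
    then show "\<exists>a. realizes N (n + length d) a F" ..
  qed
  moreover have "(\<phi>, c) \<in> q' \<or> (Neg \<phi>, c) \<in> q'"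
    if "(\<phi>, c) \<in> pformulas L (n + length d) (univ N)" for \<phi> c
    using q_complete[of \<phi> "d @ c"] that d_univ by (auto simp: q'_def pformulas_def add.assoc)
  ultimately have "q' \<in> complete_types L N (n + length d) (univ N)"
    unfolding complete_types_def by blast
  moreover have inv: "(\<phi>, c') \<in> q'"
    if c: "c \<in> tuples N m" "c' \<in> tuples N m" "tp L N c M = tp L N c' M" "(\<phi>, c) \<in> q'" for \<phi> c c' m
  proof -
    obtain \<sigma> where \<sigma>: "fixing_automorphism \<sigma>" "map \<sigma> c = c'"
      using tp_eq_imp_fixing[of c c'] c by (auto simp: tuples_def)
    \<comment> \<open>The automorphism moving \<open>c\<close> to \<open>c'\<close> fixes
      \<open>d\<close>, so the longer parameter tuples also have the same type over
      \<open>M\<close>.\<close>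
    have "tp L N (map \<sigma> (d @ c)) M = tp L N (d @ c) M"
      using d_univ c by (intro tp_fixing[OF \<sigma>(1)]) (auto simp: tuples_def)
    then have "tp L N (d @ c) M = tp L N (d @ c') M" using \<sigma> fixing_map[OF \<sigma>(1) d] by simp
    moreover have "(\<phi>, d @ c) \<in> q" "d @ c' \<in> lists (univ N)" "length (d @ c') = length (d @ c)"
      using c(1,2,4) d_univ by (auto simp: q'_def tuples_def)
    ultimately have "(\<phi>, d @ c') \<in> q" using invariantD[OF q, of \<phi> "d @ c" "d @ c'"] by blast
    then show ?thesis by (simp add: q'_def)
  qed
  ultimately show ?thesis
    unfolding invariant_type_def q'_def[symmetric]
    by (intro conjI allI ballI impI iffI) (assumption | erule inv[rotated 3]; simp)+
qed

text \<open>A Kim-dividing formula of \<open>tp(s/Ma)\<close> would be witnessed by the Morley sequence \<open>b\<close> with a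
  tuple of \<open>M\<close> adjoined to each of its members.\<close>

lemma kim_indep_imp_simultaneous:
  assumes q: "invariant_type L N M n q" and b: "morley_seq N M n q b"
    and a: "a \<in> tuples N n" "tp L N a M \<subseteq> q"
    and ind: "kim_indep L N M (set s) (set a)"
    and xs: "rev_morley n q xs"
  obtains s' where "s' \<in> tuples N (length s)" "\<And>x. x \<in> set xs \<Longrightarrow> tp L N (s' @ x) M = tp L N (s @ a) M"
proof -
  have len_a: "length a = n" and a_univ: "a \<in> lists (univ N)" using a by (auto simp: tuples_def)
  define h :: "'a list \<times> ('f, 'r, 'a) pfm \<Rightarrow> ('f, 'r, 'a) pfm" where
    "h = (\<lambda>(x, \<psi>, d). (\<psi>, x @ d))"
  \<comment> \<open>Realizing \<open>\<pi>\<close> means that \<open>s' @ x\<close> has the type of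
    \<open>s @ a\<close> over \<open>M\<close> for every \<open>x\<close> in
    \<open>xs\<close>.\<close>
  define \<pi> where "\<pi> = h ` (set xs \<times> tp L N (s @ a) M)"
  have xs_tup: "x \<in> lists (univ N) \<and> length x = n" if "x \<in> set xs" for x
    using rev_morley_tuples[OF xs that] by (simp add: tuples_def)
  obtain s' where s': "realizes N (length s) s' \<pi>"
  proof (rule realize_partial_type)
    show "\<pi> \<subseteq> pformulas L (length s) (M \<union> set (concat xs))"
      using xs_tup len_a by (fastforce simp: \<pi>_def h_def tp_def pformulas_def add.assoc)
    show "M \<union> set (concat xs) \<subseteq> univ N"
      using M_sub rev_morley_concat(1)[OF xs] by auto
    show "small \<kappa> (M \<union> set (concat xs))" by (intro small_Un M_small finite_imp_small) simp
    show "consistent N (length s) \<pi>"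
      unfolding consistent_def
    proof (intro allI impI)
      fix F assume F: "finite F \<and> F \<subseteq> \<pi>"
      then have "finite F" "F \<subseteq> h ` (set xs \<times> tp L N (s @ a) M)" by (auto simp: \<pi>_def)
      from finite_subset_image[OF this]
      obtain C where C: "C \<subseteq> set xs \<times> tp L N (s @ a) M" "finite C" "F = h ` C"
        by blast
      \<comment> \<open>The finite subset need not treat all \<open>x\<close> alike; it is
        strengthened by demanding all its formulas, joined in \<open>\<theta>\<close>, for every
        \<open>x\<close>.\<close>
      define G where "G = snd ` C"
      have G: "finite G" "G \<subseteq> tp L N (s @ a) M" using C by (auto simp: G_def)
      then have "G \<subseteq> pformulas L (length (s @ a)) M" by (auto simp: tp_def)
      then obtain \<theta> d where \<theta>d: "(\<theta>, d) \<in> pformulas L (length (s @ a)) M"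
        and iff: "\<And>y. length y = length (s @ a) \<Longrightarrow>
          holds N \<theta> (y @ d) \<longleftrightarrow> (\<forall>(\<psi>, c)\<in>G. holds N \<psi> (y @ c))"
        using ex_conj_pfm[OF G(1), of L _ M N] by blast
      have \<theta>: "\<theta> \<in> formulas L (length s + n + length d)" and d: "d \<in> lists M"
        using \<theta>d len_a by (auto simp: pformulas_def)
      have "holds N \<theta> ((s @ a) @ d)" using iff[OF refl] G(2) by (auto simp: tp_def)
      \<comment> \<open>With parameters \<open>a @ d\<close>, \<open>\<theta>\<close> lies in the
        type of \<open>s\<close> over \<open>Ma\<close>, so by independence it does not Kim-divide,
        and its instances along the Morley sequence \<open>b i @ d\<close> are consistent.\<close>
      then have "(\<theta>, a @ d) \<in> tp L N s (M \<union> set a)"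
        using \<theta> d len_a by (auto simp: tp_def pformulas_def add.assoc)
      then have "\<not> kim_forks L N M (length s) \<theta> (a @ d)"
        using ind unfolding kim_indep_def by blast
      moreover have "(\<theta>, a @ d) \<in> pformulas L (length s) (univ N)"
        using \<theta> d a_univ len_a M_sub by (auto simp: pformulas_def add.assoc)
      ultimately have no_div: "\<not> kim_divides L N M (length s) \<theta> (a @ d)"
        using kim_divides_imp_kim_forks by blast
      have "tp L N (a @ d) M \<subseteq> {(\<psi>, c). (\<psi>, d @ c) \<in> q}"
      proof (rule subrelI)
        fix \<psi> c assume "(\<psi>, c) \<in> tp L N (a @ d) M"
        then have "(\<psi>, d @ c) \<in> tp L N a M" using d by (auto simp: tp_def pformulas_def add.assoc)
        then show "(\<psi>, c) \<in> {(\<psi>, c). (\<psi>, d @ c) \<in> q}" using a(2) by blast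
      qed
      moreover have "morley_seq N M (length (a @ d)) {(\<psi>, c). (\<psi>, d @ c) \<in> q} (\<lambda>i. b i @ d)"
        unfolding morley_seq_def
      proof
        fix i
        have bi: "realizes N n (b i) (restrict_type q (M \<union> (\<Union>j<i. set (b j))))"
          using b by (simp add: morley_seq_def)
        have "holds N \<psi> ((b i @ d) @ c)"
          if "(\<psi>, d @ c) \<in> q" "c \<in> lists (M \<union> (\<Union>j<i. set (b j @ d)))" for \<psi> c
        proof -
          have "set c \<subseteq> M \<union> (\<Union>j<i. set (b j) \<union> set d)" "set d \<subseteq> M"
            using that(2) d unfolding set_append[symmetric] by (auto simp del: set_append)
          then have "set (d @ c) \<subseteq> M \<union> (\<Union>j<i. set (b j))" unfolding set_append by blast
          then have "d @ c \<in> lists (M \<union> (\<Union>j<i. set (b j)))" by (simp add: lists_eq_set)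
          then have "(\<psi>, d @ c) \<in> restrict_type q (M \<union> (\<Union>j<i. set (b j)))"
            using that(1) by (simp add: restrict_type_def)
          then show ?thesis using bi by (auto simp: realizes_def)
        qed
        moreover have "b i @ d \<in> tuples N (length (a @ d))"
          using bi d M_sub len_a by (auto simp: realizes_def tuples_def)
        ultimately show "realizes N (length (a @ d)) (b i @ d) (restrict_type
            {(\<psi>, c). (\<psi>, d @ c) \<in> q} (M \<union> (\<Union>j<i. set (b j @ d))))"
          unfolding realizes_def restrict_type_def by blast
      qed
      ultimately have "consistent N (length s) (range (\<lambda>i. (\<theta>, b i @ d)))"
        using no_div invariant_type_adjoin_base[OF q d] len_a unfolding kim_divides_def
        by (metis length_append)
      then obtain y where y: "y \<in> tuples N (length s)" "\<And>x. x \<in> set xs \<Longrightarrow> holds N \<theta> (y @ x @ d)"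
        using consistent_imp_common_solution[OF q b xs \<theta> d] by blast
      have "holds N \<psi> (y @ x @ c)" if "(x, \<psi>, c) \<in> C" for x \<psi> c
      proof -
        have x: "x \<in> set xs" and "(\<psi>, c) \<in> G" using that C(1) by (auto simp: G_def intro: rev_image_eqI)
        moreover have "holds N \<theta> ((y @ x) @ d)" using y(2)[OF x] by simp
        ultimately show ?thesis
          using iff[of "y @ x"] y(1) xs_tup[OF x] len_a by (fastforce simp: tuples_def)
      qed
      then have "realizes N (length s) y F" using y(1) by (auto simp: realizes_def C(3) h_def)
      then show "\<exists>y. realizes N (length s) y F" ..
    qed
  qed
  have s'_tup: "s' \<in> tuples N (length s)" using s' by (simp add: realizes_def)
  show thesis
  proof
    show "s' \<in> tuples N (length s)" by (rule s'_tup)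
    fix x assume x: "x \<in> set xs"
    have len: "length (s @ a) = length (s' @ x)"
      using s'_tup xs_tup[OF x] len_a by (simp add: tuples_def)
    have "tp L N (s @ a) M \<subseteq> tp L N (s' @ x) M"
    proof (rule subrelI)
      fix \<psi> d assume *: "(\<psi>, d) \<in> tp L N (s @ a) M"
      then have "(\<psi>, x @ d) \<in> \<pi>" unfolding \<pi>_def h_def using x by (intro rev_image_eqI[of "(x, \<psi>, d)"]) auto
      then have "holds N \<psi> (s' @ x @ d)" using s' by (auto simp: realizes_def)
      then show "(\<psi>, d) \<in> tp L N (s' @ x) M" using * len by (simp add: tp_def pformulas_def)
    qed
    then show "tp L N (s' @ x) M = tp L N (s @ a) M" using tp_eqI_subset len by metis
  qed
qed

end

section \<open>Trees of realizations\<close>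

text \<open>A step changes only the last entry of a node before going further up. Once the path is
  strictly above \<open>\<eta> @ [j]\<close>, that entry lies beyond this prefix, which is therefore
  kept.\<close>

lemma left_leaning_later:
  assumes l: "left_leaning l" and t: "l t = \<eta> @ [i]"
  obtains j where "j \<le> i" "\<And>t'. t < t' \<Longrightarrow> strict_prefix (\<eta> @ [j]) (l t')"
proof -
  obtain j where j: "j \<le> i" "strict_prefix (\<eta> @ [j]) (l (Suc t))"
    using l t unfolding left_leaning_def by blast
  have "strict_prefix (\<eta> @ [j]) (l (Suc t + d))" for d
  proof (induction d)
    case 0
    show ?case using j by simp
  next
    case (Suc d)
    then obtain \<zeta> where \<zeta>: "l (Suc t + d) = (\<eta> @ [j]) @ \<zeta>" "\<zeta> \<noteq> []"
      by (auto simp: strict_prefix_def prefix_def)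
    then have "l (Suc t + d) = (\<eta> @ [j] @ butlast \<zeta>) @ [last \<zeta>]" by simp
    then obtain j' where "strict_prefix ((\<eta> @ [j] @ butlast \<zeta>) @ [j']) (l (Suc (Suc t + d)))"
      using l unfolding left_leaning_def by blast
    then show ?case by (auto simp: strict_prefix_def prefix_def)
  qed
  then have "strict_prefix (\<eta> @ [j]) (l t')" if "t < t'" for t'
    using that less_iff_Suc_add[of t t'] by auto
  then show thesis using that j(1) by blast
qed

text \<open>While the path stays among the siblings of \<open>\<eta> @ [i]\<close>, the index
  \<open>j\<close> grows; once it is strictly above one of them, later steps change only entries
  beyond that prefix.\<close>

lemma right_veering_later:
  assumes r: "right_veering r" and t: "r t = \<eta> @ [i]" and "t < t'"
  shows "\<exists>j>i. prefix (\<eta> @ [j]) (r t')"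
proof -
  have "\<exists>j>i. prefix (\<eta> @ [j]) (r (Suc t + d))" for d
  proof (induction d)
    case 0
    show ?case using r t unfolding right_veering_def by simp
  next
    case (Suc d)
    then obtain j \<zeta> where j: "j > i" and \<zeta>: "r (Suc t + d) = (\<eta> @ [j]) @ \<zeta>"
      by (auto simp: prefix_def)
    show ?case
    proof (cases "\<zeta> = []")
      case True
      then have "r (Suc t + d) = \<eta> @ [j]" using \<zeta> by simp
      then obtain j' where "j' > j" "prefix (\<eta> @ [j']) (r (Suc (Suc t + d)))"
        using r unfolding right_veering_def by blast
      then show ?thesis using j by (intro exI[of _ j']) simp
    next
      case False
      then have "r (Suc t + d) = (\<eta> @ [j] @ butlast \<zeta>) @ [last \<zeta>]" using \<zeta> by simp
      then obtain j' where "prefix ((\<eta> @ [j] @ butlast \<zeta>) @ [j']) (r (Suc (Suc t + d)))"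
        using r unfolding right_veering_def by blast
      then show ?thesis using j by (intro exI[of _ j]) (auto simp: prefix_def)
    qed
  qed
  then show ?thesis using \<open>t < t'\<close> less_iff_Suc_add[of t t'] by auto
qed

definition nodes :: "nat \<Rightarrow> nat \<Rightarrow> nat list set" where
  "nodes K h = {\<eta>. \<eta> \<noteq> [] \<and> length \<eta> \<le> h \<and> set \<eta> \<subseteq> {..<K}}"

lemma finite_nodes: "finite (nodes K h)"
  by (rule finite_subset[OF _ finite_lists_length_le[of "{..<K}" h]]) (auto simp: nodes_def)

lemma Cons_nodes: "i # \<eta> \<in> nodes K (Suc h) \<longleftrightarrow> i < K \<and> (\<eta> = [] \<or> \<eta> \<in> nodes K h)"
  by (auto simp: nodes_def)

lemma finite_imp_subset_nodes:
  assumes "finite W" and "[] \<notin> W"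
  obtains h0 where "\<And>h. h0 \<le> h \<Longrightarrow> W \<subseteq> nodes h h"
proof -
  obtain h1 where h1: "\<forall>w\<in>length ` W. w \<le> h1"
    using assms(1) finite_nat_set_iff_bounded_le by blast
  obtain h2 where h2: "\<forall>w\<in>\<Union>(set ` W). w < h2"
    using assms(1) finite_nat_set_iff_bounded[of "\<Union>(set ` W)"] by auto
  have "W \<subseteq> nodes h h" if "max h1 h2 \<le> h" for h
    using h1 h2 that assms(2) by (fastforce simp: nodes_def)
  then show thesis using that by blast
qed

text \<open>\<open>c\<close> makes \<open>p\<close> and \<open>q\<close> extend the same type over
  \<open>M\<close>. In the application it is the parameter tuple of the Kim-dividing formula, and
  \<open>b\<close> is a Morley sequence along which that formula is inconsistent.\<close>

locale tree_construction = small_base \<kappa> L N M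
  for \<kappa> :: "'k rel" and L :: "('f, 'r) lang" and N :: "('f, 'r, 'a) struct" and M :: "'a set" +
  fixes m :: nat and p q :: "('f, 'r, 'a) pfm set" and b :: "nat \<Rightarrow> 'a list" and c :: "'a list"
  assumes strict_p: "kim_strict \<kappa> L N M m p" and invariant_q: "invariant_type L N M m q"
    and tp_c: "length c = m" "tp L N c M \<subseteq> p" "tp L N c M \<subseteq> q"
    and morley_b: "morley_seq N M m q b"
begin

lemma invariant_p: "invariant_type L N M m p"
  using strict_p by (simp add: kim_strict_def)

definition span :: "nat \<Rightarrow> nat \<Rightarrow> (nat list \<Rightarrow> 'a list) \<Rightarrow> 'a set" where
  "span K h S = (\<Union>\<eta>\<in>nodes K h. set (S \<eta>))"

text \<open>The strict descendants of each left sibling are taken separately in the condition on \<open>p\<close>: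
  a left-leaning path stays above one of them, and the construction gives no more.\<close>

definition tree :: "nat \<Rightarrow> nat \<Rightarrow> (nat list \<Rightarrow> 'a list) \<Rightarrow> bool" where
  "tree K h S \<longleftrightarrow> (\<forall>\<eta> i. \<eta> @ [i] \<in> nodes K h \<longrightarrow>
     (\<forall>j\<le>i. realizes N m (S (\<eta> @ [i])) (restrict_type p
        (M \<union> (\<Union>\<nu>\<in>{\<nu> \<in> nodes K h. strict_prefix (\<eta> @ [j]) \<nu>}. set (S \<nu>))))) \<and>
     realizes N m (S (\<eta> @ [i])) (restrict_type q
        (M \<union> (\<Union>\<nu>\<in>{\<nu> \<in> nodes K h. \<exists>j>i. prefix (\<eta> @ [j]) \<nu>}. set (S \<nu>)))))"

lemma tree_tuples:
  assumes "tree K h S" and "\<eta> \<in> nodes K h"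
  shows "S \<eta> \<in> tuples N m"
proof -
  have "\<eta> = butlast \<eta> @ [last \<eta>]" using assms(2) by (simp add: nodes_def)
  then show ?thesis using assms unfolding tree_def realizes_def by metis
qed

lemma tree_span:
  assumes "tree K h S"
  shows "span K h S \<subseteq> univ N" "finite (span K h S)"
proof -
  show "span K h S \<subseteq> univ N"
    using tree_tuples[OF assms] by (fastforce simp: span_def tuples_def)
  show "finite (span K h S)" by (simp add: span_def finite_nodes)
qed

lemma tree_fixing:
  assumes S: "tree K h S" and \<sigma>: "fixing_automorphism \<sigma>"
  shows "tree K h (\<lambda>\<eta>. map \<sigma> (S \<eta>))"
  unfolding tree_def
proof (intro allI impI conjI)
  fix \<eta> i assume node: "\<eta> @ [i] \<in> nodes K h"
  have sub: "(\<Union>\<nu>\<in>V. set (S \<nu>)) \<subseteq> univ N" if "V \<subseteq> nodes K h" for V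
    using tree_span(1)[OF S] that by (auto simp: span_def)
  have img: "(\<Union>\<nu>\<in>V. set (map \<sigma> (S \<nu>))) = \<sigma> ` (\<Union>\<nu>\<in>V. set (S \<nu>))" for V
    by (simp add: image_UN)
  show "realizes N m (map \<sigma> (S (\<eta> @ [i]))) (restrict_type p
        (M \<union> (\<Union>\<nu>\<in>{\<nu> \<in> nodes K h. strict_prefix (\<eta> @ [j]) \<nu>}. set (map \<sigma> (S \<nu>)))))"
    if "j \<le> i" for j
    unfolding img by (rule realizes_fixing[OF invariant_p _ sub \<sigma>])
      (use S node that in \<open>auto simp: tree_def\<close>)
  show "realizes N m (map \<sigma> (S (\<eta> @ [i]))) (restrict_type q
        (M \<union> (\<Union>\<nu>\<in>{\<nu> \<in> nodes K h. \<exists>j>i. prefix (\<eta> @ [j]) \<nu>}. set (map \<sigma> (S \<nu>)))))"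
    unfolding img by (rule realizes_fixing[OF invariant_q _ sub \<sigma>])
      (use S node in \<open>auto simp: tree_def\<close>)
qed

text \<open>\<open>A i\<close> are the roots and \<open>SS i\<close> the trees above them. In the
  induction step the new sibling gets index \<open>0\<close> and the others move up by one. Roots
  placed earlier must realize \<open>p\<close> over the new tree too; the simultaneous copy
  \<open>s'\<close> achieves this.\<close>

lemma siblings:
  fixes r :: nat
  assumes S: "tree K h S"
  shows "\<exists>A SS. (\<forall>i<r. tree K h (SS i)) \<and>
    (\<forall>i<r. \<forall>j\<le>i. realizes N m (A i) (restrict_type p (M \<union> span K h (SS j)))) \<and>
    (\<forall>i<r. realizes N m (A i) (restrict_type q
       (M \<union> (\<Union>j\<in>{i<..<r}. set (A j) \<union> span K h (SS j)))))"
proof (induction r)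
  case (Suc r)
  then obtain A SS where trees: "\<And>i. i < r \<Longrightarrow> tree K h (SS i)"
    and Ap: "\<And>i j. i < r \<Longrightarrow> j \<le> i \<Longrightarrow> realizes N m (A i) (restrict_type p (M \<union> span K h (SS j)))"
    and Aq: "\<And>i. i < r \<Longrightarrow> realizes N m (A i) (restrict_type q
       (M \<union> (\<Union>j\<in>{i<..<r}. set (A j) \<union> span K h (SS j))))"
    by blast
  have A_tup: "A i \<in> tuples N m" if "i < r" for i using Aq[OF that] by (simp add: realizes_def)
  obtain s where s: "set s = span K h S" using finite_list[OF tree_span(2)[OF S]] by blast
  have s_univ: "s \<in> lists (univ N)" using s tree_span(1)[OF S] by (simp add: lists_eq_set)
  obtain a where a: "realizes N m a (restrict_type p (M \<union> set s))"
    using realize_invariant[OF invariant_p] s_univ by (auto simp: lists_eq_set)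
  have a_tup: "a \<in> tuples N m" using a by (simp add: realizes_def)
  have ind: "kim_indep L N M (set s) (set a)"
    using strict_p a s_univ finite_imp_small[of "set s"] by (simp add: kim_strict_def lists_eq_set)
  \<comment> \<open>\<open>a\<close> realizes \<open>p\<close> over \<open>M\<close>, hence has the
    type of \<open>c\<close>, which \<open>q\<close> extends as well.\<close>
  have "tp L N c M \<subseteq> tp L N a M"
  proof (rule subrelI)
    fix \<psi> d assume *: "(\<psi>, d) \<in> tp L N c M"
    then have "d \<in> lists M" by (simp add: tp_def pformulas_def)
    then have "(\<psi>, d) \<in> restrict_type p (M \<union> set s)"
      using * tp_c(2) by (auto simp: restrict_type_def)
    then have "holds N \<psi> (a @ d)" using a by (auto simp: realizes_def)
    then show "(\<psi>, d) \<in> tp L N a M"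
      using * a_tup tp_c(1) by (simp add: tp_def pformulas_def tuples_def)
  qed
  then have "tp L N c M = tp L N a M"
    by (rule tp_eqI_subset) (use tp_c(1) a_tup in \<open>simp add: tuples_def\<close>)
  then have tp_a: "tp L N a M \<subseteq> q" using tp_c(3) by simp
  \<comment> \<open>Everything placed so far; the new root \<open>a0\<close> realizes
    \<open>q\<close> over it.\<close>
  define B where "B = (\<Union>j<r. set (A j) \<union> span K h (SS j))"
  have "set (A i) \<subseteq> univ N" if "i < r" for i
    using A_tup[OF that] by (simp add: tuples_def lists_eq_set)
  then have "B \<subseteq> univ N" using tree_span(1)[OF trees] unfolding B_def by blast
  moreover have "finite B" using tree_span(2)[OF trees] by (auto simp: B_def)
  ultimately obtain a0 where a0: "realizes N m a0 (restrict_type q (M \<union> B))"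
    using realize_invariant[OF invariant_q] by blast
  \<comment> \<open>Read from right to left, the roots form a Morley sequence of \<open>q\<close>,
    so the tuple \<open>s\<close> can be copied over all of them at once.\<close>
  have "rev_morley m q (map A [0..<r])"
  proof (rule rev_morley_map)
    fix t assume t: "t \<in> set [0..<r]"
    show "realizes N m (A t) (restrict_type q (M \<union> (\<Union>t'\<in>{t' \<in> set [0..<r]. t < t'}. set (A t'))))"
      by (rule realizes_restrict_mono[OF Aq]) (use t in auto)
  qed simp
  moreover have "realizes N m a0 (restrict_type q (M \<union> set (concat (map A [0..<r]))))"
    by (rule realizes_restrict_mono[OF a0]) (auto simp: B_def)
  ultimately have xs: "rev_morley m q (a0 # map A [0..<r])" by simp
  obtain s' where s': "s' \<in> tuples N (length s)"
    and tp_s': "\<And>x. x \<in> set (a0 # map A [0..<r]) \<Longrightarrow> tp L N (s' @ x) M = tp L N (s @ a) M"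
    using kim_indep_imp_simultaneous[OF invariant_q morley_b a_tup tp_a ind xs] by blast
  \<comment> \<open>The automorphism depends on the root \<open>x\<close>, but each of them takes
    \<open>s\<close> to the same \<open>s'\<close>.\<close>
  have moved: "\<exists>\<sigma>. fixing_automorphism \<sigma> \<and> map \<sigma> s = s' \<and> map \<sigma> a = x"
    if x: "x \<in> set (a0 # map A [0..<r])" for x
  proof -
    have x_tup: "x \<in> tuples N m" using rev_morley_tuples[OF xs x] .
    obtain \<sigma> where "fixing_automorphism \<sigma>" "map \<sigma> (s @ a) = s' @ x"
    proof (rule tp_eq_imp_fixing)
      show "s @ a \<in> lists (univ N)" "s' @ x \<in> lists (univ N)" "length (s @ a) = length (s' @ x)"
        using s_univ a_tup s' x_tup by (auto simp: tuples_def)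
      show "tp L N (s @ a) M = tp L N (s' @ x) M" using tp_s'[OF x] by simp
    qed
    then show ?thesis using s' by (intro exI[of _ \<sigma>]) (auto simp: tuples_def)
  qed
  \<comment> \<open>Since \<open>a\<close> realizes \<open>p\<close> over \<open>s\<close>, each
    root, old or new, realizes \<open>p\<close> over \<open>s'\<close>.\<close>
  have xp: "realizes N m x (restrict_type p (M \<union> set s'))" if "x \<in> set (a0 # map A [0..<r])" for x
  proof -
    obtain \<sigma> where \<sigma>: "fixing_automorphism \<sigma>" "map \<sigma> s = s'" "map \<sigma> a = x" using moved[OF \<open>x \<in> _\<close>] by blast
    have "realizes N m (map \<sigma> a) (restrict_type p (M \<union> \<sigma> ` set s))"
      by (rule realizes_fixing[OF invariant_p a _ \<sigma>(1)]) (use s_univ in \<open>simp add: lists_eq_set\<close>)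
    moreover have "\<sigma> ` set s = set s'" using \<sigma>(2) by (metis set_map)
    ultimately show ?thesis using \<sigma>(3) by simp
  qed
  \<comment> \<open>One of these automorphisms is enough to copy the tree: the conditions on
    \<open>p\<close> refer only to the span, which is the set of entries of
    \<open>s'\<close>.\<close>
  obtain \<sigma> where \<sigma>: "fixing_automorphism \<sigma>" "map \<sigma> s = s'" using moved[of a0] by auto
  define S' where "S' = (\<lambda>\<eta>. map \<sigma> (S \<eta>))"
  have S': "tree K h S'" unfolding S'_def by (rule tree_fixing[OF S \<sigma>(1)])
  have span_S': "span K h S' = set s'"
  proof -
    have "span K h S' = \<sigma> ` set s" unfolding s by (simp add: span_def S'_def image_UN)
    then show ?thesis using \<sigma>(2) by (metis set_map)
  qed
  define A' where "A' = case_nat a0 A"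
  define SS' where "SS' = case_nat S' SS"
  have "tree K h (SS' i)" if "i < Suc r" for i
    using that S' trees by (cases i) (auto simp: SS'_def)
  moreover have "realizes N m (A' i) (restrict_type p (M \<union> span K h (SS' j)))"
    if ij: "i < Suc r" "j \<le> i" for i j
  proof (cases j)
    case 0
    have "A' i \<in> set (a0 # map A [0..<r])" using that by (cases i) (auto simp: A'_def)
    then show ?thesis using xp 0 by (simp add: SS'_def span_S')
  next
    case (Suc j')
    then obtain i' where "i = Suc i'" using ij by (cases i) auto
    then show ?thesis using Ap[of i' j'] Suc that by (simp add: A'_def SS'_def)
  qed
  moreover have "realizes N m (A' i) (restrict_type q
       (M \<union> (\<Union>j\<in>{i<..<Suc r}. set (A' j) \<union> span K h (SS' j))))" if "i < Suc r" for i
  proof (cases i)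
    case 0
    have "(\<Union>j\<in>{i<..<Suc r}. set (A' j) \<union> span K h (SS' j)) \<subseteq> B"
    proof (rule UN_least)
      fix j assume "j \<in> {i<..<Suc r}"
      then obtain j' where "j = Suc j'" "j' < r" using 0 by (cases j) auto
      then show "set (A' j) \<union> span K h (SS' j) \<subseteq> B" by (auto simp: A'_def SS'_def B_def)
    qed
    then have "realizes N m a0 (restrict_type q
       (M \<union> (\<Union>j\<in>{i<..<Suc r}. set (A' j) \<union> span K h (SS' j))))"
      by (intro realizes_restrict_mono[OF a0] Un_mono order_refl)
    then show ?thesis using 0 by (simp add: A'_def)
  next
    case (Suc i')
    have "(\<Union>j\<in>{i<..<Suc r}. set (A' j) \<union> span K h (SS' j)) \<subseteq>
      (\<Union>j\<in>{i'<..<r}. set (A j) \<union> span K h (SS j))"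
    proof (rule UN_least)
      fix j assume "j \<in> {i<..<Suc r}"
      then obtain j' where j': "j = Suc j'" "j' \<in> {i'<..<r}" using Suc by (cases j) auto
      show "set (A' j) \<union> span K h (SS' j) \<subseteq> (\<Union>j\<in>{i'<..<r}. set (A j) \<union> span K h (SS j))"
        unfolding A'_def SS'_def j'(1) nat.case by (rule UN_upper[OF j'(2)])
    qed
    then have "realizes N m (A i') (restrict_type q
       (M \<union> (\<Union>j\<in>{i<..<Suc r}. set (A' j) \<union> span K h (SS' j))))"
      using that Suc by (intro realizes_restrict_mono[OF Aq[of i']] Un_mono order_refl) simp_all
    then show ?thesis using Suc by (simp add: A'_def)
  qed
  ultimately show ?case by (intro exI[of _ A'] exI[of _ SS'] conjI allI impI)
qed simp

text \<open>Induction on the height: a tree of height \<open>h\<close> is hung above each of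
  \<open>K\<close> siblings.\<close>

lemma ex_tree: "\<exists>S. tree K h S"
proof (induction h)
  case 0
  have "nodes K 0 = {}" by (auto simp: nodes_def)
  then show ?case by (simp add: tree_def)
next
  case (Suc h)
  then obtain S where "tree K h S" by blast
  from siblings[OF this, of K] obtain A SS where trees: "\<And>i. i < K \<Longrightarrow> tree K h (SS i)"
    and Ap: "\<And>i j. i < K \<Longrightarrow> j \<le> i \<Longrightarrow> realizes N m (A i) (restrict_type p (M \<union> span K h (SS j)))"
    and Aq: "\<And>i. i < K \<Longrightarrow> realizes N m (A i) (restrict_type q
       (M \<union> (\<Union>j\<in>{i<..<K}. set (A j) \<union> span K h (SS j))))"
    by blast
  \<comment> \<open>The head of a node chooses the sibling, the tail the place above it; an empty
    tail means the root itself.\<close>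
  define S' where "S' \<eta> = (if tl \<eta> = [] then A (hd \<eta>) else SS (hd \<eta>) (tl \<eta>))" for \<eta>
  have "tree K (Suc h) S'"
    unfolding tree_def
  proof (intro allI impI)
    fix \<eta> i assume node: "\<eta> @ [i] \<in> nodes K (Suc h)"
    let ?P = "\<lambda>j. {\<nu> \<in> nodes K (Suc h). strict_prefix (\<eta> @ [j]) \<nu>}"
    let ?Q = "{\<nu> \<in> nodes K (Suc h). \<exists>j>i. prefix (\<eta> @ [j]) \<nu>}"
    show "(\<forall>j\<le>i. realizes N m (S' (\<eta> @ [i])) (restrict_type p (M \<union> (\<Union>\<nu>\<in>?P j. set (S' \<nu>))))) \<and>
      realizes N m (S' (\<eta> @ [i])) (restrict_type q (M \<union> (\<Union>\<nu>\<in>?Q. set (S' \<nu>))))"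
    proof (cases \<eta>)
      case Nil
      then have i: "i < K" using node by (simp add: nodes_def)
      have S'_i: "S' (\<eta> @ [i]) = A i" using Nil by (simp add: S'_def)
      have P: "(\<Union>\<nu>\<in>?P j. set (S' \<nu>)) \<subseteq> span K h (SS j)" for j
      proof (rule UN_least)
        fix \<nu> assume "\<nu> \<in> ?P j"
        then have *: "prefix [j] \<nu>" "\<nu> \<noteq> [j]" "\<nu> \<in> nodes K (Suc h)"
          using Nil by (auto simp: strict_prefix_def)
        from *(1) obtain \<nu>' where "\<nu> = j # \<nu>'" by (auto simp: prefix_def)
        moreover from this * have "\<nu>' \<noteq> []" "\<nu>' \<in> nodes K h" by (auto simp: Cons_nodes)
        ultimately show "set (S' \<nu>) \<subseteq> span K h (SS j)" by (auto simp: S'_def span_def)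
      qed
      have Q: "(\<Union>\<nu>\<in>?Q. set (S' \<nu>)) \<subseteq> (\<Union>j\<in>{i<..<K}. set (A j) \<union> span K h (SS j))"
      proof (rule UN_least)
        fix \<nu> assume "\<nu> \<in> ?Q"
        then obtain j \<nu>' where *: "\<nu> = j # \<nu>'" "\<nu>' = [] \<or> \<nu>' \<in> nodes K h" "j \<in> {i<..<K}"
          using Nil by (auto simp: prefix_def Cons_nodes)
        then have "set (S' \<nu>) \<subseteq> set (A j) \<union> span K h (SS j)" by (auto simp: S'_def span_def)
        also have "\<dots> \<subseteq> (\<Union>j\<in>{i<..<K}. set (A j) \<union> span K h (SS j))"
          by (rule UN_upper[OF *(3)])
        finally show "set (S' \<nu>) \<subseteq> (\<Union>j\<in>{i<..<K}. set (A j) \<union> span K h (SS j))" .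
      qed
      have "realizes N m (A i) (restrict_type p (M \<union> (\<Union>\<nu>\<in>?P j. set (S' \<nu>))))" if "j \<le> i" for j
        by (rule realizes_restrict_mono[OF Ap[OF i that] Un_mono[OF order_refl P]])
      moreover have "realizes N m (A i) (restrict_type q (M \<union> (\<Union>\<nu>\<in>?Q. set (S' \<nu>))))"
        by (rule realizes_restrict_mono[OF Aq[OF i] Un_mono[OF order_refl Q]])
      ultimately show ?thesis unfolding S'_i by blast
    next
      \<comment> \<open>Higher up, a node's siblings and their descendants lie in the same tree
        \<open>SS i0\<close>, whose own conditions apply.\<close>
      case (Cons i0 \<eta>')
      then have i0: "i0 < K" and node': "\<eta>' @ [i] \<in> nodes K h"
        using node by (auto simp: Cons_nodes)
      have S'_i: "S' (\<eta> @ [i]) = SS i0 (\<eta>' @ [i])" using Cons by (simp add: S'_def)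
      have P: "(\<Union>\<nu>\<in>?P j. set (S' \<nu>)) \<subseteq>
        (\<Union>\<nu>\<in>{\<nu> \<in> nodes K h. strict_prefix (\<eta>' @ [j]) \<nu>}. set (SS i0 \<nu>))" for j
      proof (rule UN_least)
        fix \<nu> assume "\<nu> \<in> ?P j"
        then have *: "strict_prefix (i0 # \<eta>' @ [j]) \<nu>" "\<nu> \<in> nodes K (Suc h)" using Cons by auto
        from *(1) obtain \<nu>' where "\<nu> = i0 # \<nu>'" by (auto simp: strict_prefix_def prefix_def)
        moreover from this * have "strict_prefix (\<eta>' @ [j]) \<nu>'" by simp
        moreover from this have "\<nu>' \<noteq> []" by auto
        moreover from calculation * have "\<nu>' \<in> nodes K h" by (simp add: Cons_nodes)
        ultimately show "set (S' \<nu>) \<subseteq>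
          (\<Union>\<nu>\<in>{\<nu> \<in> nodes K h. strict_prefix (\<eta>' @ [j]) \<nu>}. set (SS i0 \<nu>))"
          by (auto simp: S'_def)
      qed
      have Q: "(\<Union>\<nu>\<in>?Q. set (S' \<nu>)) \<subseteq>
        (\<Union>\<nu>\<in>{\<nu> \<in> nodes K h. \<exists>j>i. prefix (\<eta>' @ [j]) \<nu>}. set (SS i0 \<nu>))"
      proof (rule UN_least)
        fix \<nu> assume "\<nu> \<in> ?Q"
        then obtain j \<nu>' where "\<nu> = i0 # \<nu>'" "\<nu>' \<noteq> []" "\<nu>' \<in> nodes K h" "j > i"
          "prefix (\<eta>' @ [j]) \<nu>'"
          using Cons by (auto simp: prefix_def Cons_nodes)
        then show "set (S' \<nu>) \<subseteq>
          (\<Union>\<nu>\<in>{\<nu> \<in> nodes K h. \<exists>j>i. prefix (\<eta>' @ [j]) \<nu>}. set (SS i0 \<nu>))"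
          by (auto simp: S'_def)
      qed
      have 1: "realizes N m (SS i0 (\<eta>' @ [i])) (restrict_type p
        (M \<union> (\<Union>\<nu>\<in>{\<nu> \<in> nodes K h. strict_prefix (\<eta>' @ [j]) \<nu>}. set (SS i0 \<nu>))))" if "j \<le> i" for j
        using trees[OF i0] node' that unfolding tree_def by blast
      have 2: "realizes N m (SS i0 (\<eta>' @ [i])) (restrict_type q
        (M \<union> (\<Union>\<nu>\<in>{\<nu> \<in> nodes K h. \<exists>j>i. prefix (\<eta>' @ [j]) \<nu>}. set (SS i0 \<nu>))))"
        using trees[OF i0] node' unfolding tree_def by blast
      have "realizes N m (SS i0 (\<eta>' @ [i])) (restrict_type p (M \<union> (\<Union>\<nu>\<in>?P j. set (S' \<nu>))))"
        if "j \<le> i" for j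
        by (rule realizes_restrict_mono[OF 1[OF that] Un_mono[OF order_refl P]])
      moreover have "realizes N m (SS i0 (\<eta>' @ [i])) (restrict_type q (M \<union> (\<Union>\<nu>\<in>?Q. set (S' \<nu>))))"
        by (rule realizes_restrict_mono[OF 2 Un_mono[OF order_refl Q]])
      ultimately show ?thesis unfolding S'_i by blast
    qed
  qed
  then show ?case by blast
qed

text \<open>All later nodes lie strictly above a single weakly left sibling of the present one, so
  the condition on \<open>p\<close> covers them.\<close>

lemma tree_left_leaning:
  assumes S: "tree K h S" and l: "left_leaning l" and nodes: "\<And>t. t < r \<Longrightarrow> l t \<in> nodes K h"
  shows "rev_morley m p (map (\<lambda>t. S (l t)) [0..<r])"
proof (rule rev_morley_map)
  fix t assume "t \<in> set [0..<r]"
  then have t: "t < r" by simp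
  define \<eta> i where "\<eta> = butlast (l t)" and "i = last (l t)"
  have \<eta>: "l t = \<eta> @ [i]" using l by (simp add: left_leaning_def \<eta>_def i_def)
  obtain j where j: "j \<le> i" "\<And>t'. t < t' \<Longrightarrow> strict_prefix (\<eta> @ [j]) (l t')"
    using left_leaning_later[OF l \<eta>] by blast
  have "realizes N m (S (\<eta> @ [i])) (restrict_type p
        (M \<union> (\<Union>\<nu>\<in>{\<nu> \<in> nodes K h. strict_prefix (\<eta> @ [j]) \<nu>}. set (S \<nu>))))"
    using S nodes[OF t] j(1) unfolding tree_def \<eta> by blast
  then show "realizes N m (S (l t)) (restrict_type p
      (M \<union> (\<Union>t'\<in>{t' \<in> set [0..<r]. t < t'}. set (S (l t')))))"
    unfolding \<eta> by (rule realizes_restrict_mono) (use nodes j(2) in fastforce)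
qed simp

text \<open>All later nodes are right siblings of the present one or lie above them, so the
  condition on \<open>q\<close> covers them. Arbitrary finite index sets occur because
  \<open>k\<close>-inconsistency is about any \<open>k\<close> indices.\<close>

lemma tree_right_veering:
  assumes S: "tree K h S" and \<rho>: "right_veering \<rho>" and I: "finite I"
    and nodes: "\<And>t. t \<in> I \<Longrightarrow> \<rho> t \<in> nodes K h"
  shows "rev_morley m q (map (\<lambda>t. S (\<rho> t)) (sorted_list_of_set I))"
proof (rule rev_morley_map)
  show "sorted_wrt (<) (sorted_list_of_set I)" by simp
  fix t assume "t \<in> set (sorted_list_of_set I)"
  then have t: "t \<in> I" using I by simp
  define \<eta> i where "\<eta> = butlast (\<rho> t)" and "i = last (\<rho> t)"
  have \<eta>: "\<rho> t = \<eta> @ [i]" using \<rho> by (simp add: right_veering_def \<eta>_def i_def)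
  have "realizes N m (S (\<eta> @ [i])) (restrict_type q
        (M \<union> (\<Union>\<nu>\<in>{\<nu> \<in> nodes K h. \<exists>j>i. prefix (\<eta> @ [j]) \<nu>}. set (S \<nu>))))"
    using S nodes[OF t] unfolding tree_def \<eta> by blast
  then show "realizes N m (S (\<rho> t)) (restrict_type q
      (M \<union> (\<Union>t'\<in>{t' \<in> set (sorted_list_of_set I). t < t'}. set (S (\<rho> t')))))"
    unfolding \<eta> by (rule realizes_restrict_mono)
      (use nodes right_veering_later[OF \<rho> \<eta>] I in fastforce)
qed

end

section \<open>From finite trees to an infinite one\<close>

context tree_construction
begin

text \<open>The conditions on paths become formulas in variables indexed by nodes and coordinates.
  Each mentions finitely many nodes, hence holds in all sufficiently large finite trees, and
  compactness yields a tree satisfying all of them.\<close>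

lemma has_BTP:
  assumes \<phi>: "\<phi> \<in> formulas L (n + m)"
    and p_cons: "\<And>xs. rev_morley m p xs \<Longrightarrow> \<exists>y\<in>tuples N n. \<forall>x\<in>set xs. holds N \<phi> (y @ x)"
    and q_incons: "\<And>xs. rev_morley m q xs \<Longrightarrow> length xs = k \<Longrightarrow>
      \<not> (\<exists>y\<in>tuples N n. \<forall>x\<in>set xs. holds N \<phi> (y @ x))"
  shows "has_BTP N n m \<phi> k"
proof -
  \<comment> \<open>The variables for the entries of the tuple at \<open>\<eta>\<close>, numbered by
    a coding of pairs.\<close>
  define vars :: "nat list \<Rightarrow> nat list" where "vars \<eta> = map (\<lambda>u. to_nat (\<eta>, u)) [0..<m]" for \<eta>
  have "\<exists>\<gamma>. wf_fm L \<gamma> \<and> (\<forall>e. sat N e \<gamma> \<longleftrightarrow>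
    (\<exists>y\<in>tuples N n. \<forall>\<eta>\<in>set \<eta>s. holds N \<phi> (y @ map e (vars \<eta>))))" for \<eta>s
  proof -
    have "\<phi> \<in> formulas L (n + m + 0)" using \<phi> by simp
    then obtain \<chi> where \<chi>: "\<chi> \<in> formulas L (length \<eta>s * m + 0)"
      and iff: "\<And>xs d. length xs = length \<eta>s \<Longrightarrow> (\<And>x. x \<in> set xs \<Longrightarrow> length x = m) \<Longrightarrow> length d = 0 \<Longrightarrow>
        holds N \<chi> (concat xs @ d) \<longleftrightarrow> (\<exists>y\<in>tuples N n. \<forall>x\<in>set xs. holds N \<phi> (y @ x @ d))"
      using ex_common_solution_fm[of \<phi> L n m 0 "length \<eta>s" N] by blast
    \<comment> \<open>Variable \<open>u\<close> of \<open>\<chi>\<close> stands for entry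
      \<open>u\<close> of the concatenated tuples; \<open>g\<close> replaces it by the variable
      reserved for that entry.\<close>
    define g where "g u = concat (map vars \<eta>s) ! u" for u
    have len: "length (concat (map vars \<eta>s)) = length \<eta>s * m"
      using length_concat_const[of "map vars \<eta>s" m] by (fastforce simp: vars_def)
    have "sat N e (rename g \<chi>) \<longleftrightarrow>
      (\<exists>y\<in>tuples N n. \<forall>\<eta>\<in>set \<eta>s. holds N \<phi> (y @ map e (vars \<eta>)))" for e
    proof -
      have "sat N e (rename g \<chi>) \<longleftrightarrow> holds N \<chi> (map e (concat (map vars \<eta>s)))"
        unfolding sat_rename by (rule holds_cong[OF \<chi>]) (simp add: g_def len)
      also have "map e (concat (map vars \<eta>s)) = concat (map (\<lambda>\<eta>. map e (vars \<eta>)) \<eta>s) @ []"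
        by (simp add: map_concat comp_def)
      also have "holds N \<chi> (concat (map (\<lambda>\<eta>. map e (vars \<eta>)) \<eta>s) @ []) \<longleftrightarrow>
        (\<exists>y\<in>tuples N n. \<forall>x\<in>set (map (\<lambda>\<eta>. map e (vars \<eta>)) \<eta>s). holds N \<phi> (y @ x @ []))"
        by (rule iff) (auto simp: vars_def)
      finally show ?thesis by simp
    qed
    moreover have "wf_fm L (rename g \<chi>)" using \<chi> by (simp add: formulas_def wf_rename)
    ultimately show ?thesis by blast
  qed
  then obtain \<gamma> where \<gamma>_wf: "\<And>\<eta>s. wf_fm L (\<gamma> \<eta>s)" and \<gamma>: "\<And>\<eta>s e. sat N e (\<gamma> \<eta>s) \<longleftrightarrow>
    (\<exists>y\<in>tuples N n. \<forall>\<eta>\<in>set \<eta>s. holds N \<phi> (y @ map e (vars \<eta>)))"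
    by metis
  \<comment> \<open>For left-leaning paths initial segments suffice, since every finite set of
    indices lies in one.\<close>
  define \<Gamma>\<^sub>l where "\<Gamma>\<^sub>l = {\<gamma> (map l [0..<r]) | l r. left_leaning l}"
  define \<Gamma>\<^sub>r where "\<Gamma>\<^sub>r = {Neg (\<gamma> (map \<rho> (sorted_list_of_set I))) | \<rho> I.
    right_veering \<rho> \<and> finite I \<and> card I = k}"
  \<comment> \<open>Height and width are both \<open>h\<close>, so that one number measures the size
    of a tree.\<close>
  define agrees where "agrees e h S \<longleftrightarrow> tree h h S \<and> (\<forall>\<eta>\<in>nodes h h. map e (vars \<eta>) = S \<eta>)"
    for e h S
  have large: "\<exists>h0. \<forall>h\<ge>h0. \<forall>e S. agrees e h S \<longrightarrow> sat N e \<delta>" if "\<delta> \<in> \<Gamma>\<^sub>l \<union> \<Gamma>\<^sub>r" for \<delta>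
    using that
  proof
    assume "\<delta> \<in> \<Gamma>\<^sub>l"
    then obtain l r where \<delta>: "\<delta> = \<gamma> (map l [0..<r])" and l: "left_leaning l"
      by (auto simp: \<Gamma>\<^sub>l_def)
    have "finite (l ` {..<r})" "[] \<notin> l ` {..<r}" using l unfolding left_leaning_def by (simp, metis imageE)
    then obtain h0 where h0: "\<And>h. h0 \<le> h \<Longrightarrow> l ` {..<r} \<subseteq> nodes h h"
      using finite_imp_subset_nodes by blast
    have "sat N e \<delta>" if "h0 \<le> h" and agr: "agrees e h S" for h e S
    proof -
      have nodes: "l t \<in> nodes h h" if "t < r" for t using h0[OF \<open>h0 \<le> h\<close>] that by auto
      have "rev_morley m p (map (\<lambda>t. S (l t)) [0..<r])"
        by (rule tree_left_leaning[OF _ l nodes]) (use agr in \<open>simp add: agrees_def\<close>)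
      then obtain y where y: "y \<in> tuples N n" "\<forall>x\<in>set (map (\<lambda>t. S (l t)) [0..<r]). holds N \<phi> (y @ x)"
        using p_cons by blast
      have "holds N \<phi> (y @ map e (vars (l t)))" if "t < r" for t
        using y(2) agr nodes[OF that] that by (simp add: agrees_def)
      then show ?thesis using y(1) unfolding \<delta> \<gamma> by (intro bexI[of _ y]) auto
    qed
    then show ?thesis by blast
  next
    assume "\<delta> \<in> \<Gamma>\<^sub>r"
    then obtain \<rho> I where \<delta>: "\<delta> = Neg (\<gamma> (map \<rho> (sorted_list_of_set I)))"
      and \<rho>: "right_veering \<rho>" and I: "finite I" "card I = k"
      by (auto simp: \<Gamma>\<^sub>r_def)
    have "finite (\<rho> ` I)" "[] \<notin> \<rho> ` I" using I \<rho> unfolding right_veering_def by (simp, metis imageE)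
    then obtain h0 where h0: "\<And>h. h0 \<le> h \<Longrightarrow> \<rho> ` I \<subseteq> nodes h h"
      using finite_imp_subset_nodes by blast
    have "sat N e \<delta>" if "h0 \<le> h" and agr: "agrees e h S" for h e S
    proof -
      have nodes: "\<rho> t \<in> nodes h h" if "t \<in> I" for t using h0[OF \<open>h0 \<le> h\<close>] that by auto
      have "rev_morley m q (map (\<lambda>t. S (\<rho> t)) (sorted_list_of_set I))"
        by (rule tree_right_veering[OF _ \<rho> I(1) nodes]) (use agr in \<open>simp add: agrees_def\<close>)
      then have no: "\<not> (\<exists>y\<in>tuples N n. \<forall>x\<in>set (map (\<lambda>t. S (\<rho> t)) (sorted_list_of_set I)). holds N \<phi> (y @ x))"
        by (rule q_incons) (simp add: I)
      have "map e (vars (\<rho> t)) = S (\<rho> t)" if "t \<in> I" for t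
        using agr nodes[OF that] by (simp add: agrees_def)
      then show ?thesis using no I(1) unfolding \<delta> by (simp add: \<gamma>)
    qed
    then show ?thesis by blast
  qed
  have agrees_ex: "\<exists>e S. range e \<subseteq> univ N \<and> agrees e h S" for h
  proof -
    obtain S where S: "tree h h S" using ex_tree by blast
    obtain d0 where d0: "d0 \<in> univ N" using struct by (auto simp: is_struct_def)
    \<comment> \<open>Codes of positions outside the tree may give values outside the universe;
      these are replaced by the default \<open>d0\<close>.\<close>
    define e where "e v = (case from_nat v of (\<eta>, u) \<Rightarrow> if S \<eta> ! u \<in> univ N then S \<eta> ! u else d0)" for v
    have "range e \<subseteq> univ N" using d0 by (auto simp: e_def split: prod.splits)
    moreover have "map e (vars \<eta>) = S \<eta>" if "\<eta> \<in> nodes h h" for \<eta>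
      using tree_tuples[OF S that] by (intro nth_equalityI) (auto simp: vars_def e_def tuples_def)
    ultimately show ?thesis using S unfolding agrees_def by blast
  qed
  obtain e where e_univ: "range e \<subseteq> univ N" and e: "\<And>\<delta>. \<delta> \<in> \<Gamma>\<^sub>l \<union> \<Gamma>\<^sub>r \<Longrightarrow> sat N e \<delta>"
  proof (rule countable_compactness[of "\<Gamma>\<^sub>l \<union> \<Gamma>\<^sub>r"])
    show "wf_fm L \<delta>" if "\<delta> \<in> \<Gamma>\<^sub>l \<union> \<Gamma>\<^sub>r" for \<delta>
      using that \<gamma>_wf by (auto simp: \<Gamma>\<^sub>l_def \<Gamma>\<^sub>r_def)
    fix F assume F: "finite F" "F \<subseteq> \<Gamma>\<^sub>l \<union> \<Gamma>\<^sub>r"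
    then have "\<forall>\<delta>\<in>F. \<exists>h0. \<forall>h\<ge>h0. \<forall>e S. agrees e h S \<longrightarrow> sat N e \<delta>" using large by blast
    then obtain h0 where h0: "\<And>\<delta> h e S. \<delta> \<in> F \<Longrightarrow> h0 \<delta> \<le> h \<Longrightarrow> agrees e h S \<Longrightarrow> sat N e \<delta>"
      by metis
    \<comment> \<open>A size that exceeds or equals every \<open>h0 \<delta>\<close>.\<close>
    define h where "h = sum h0 F"
    obtain e S where "range e \<subseteq> univ N" "agrees e h S" using agrees_ex by blast
    moreover have "h0 \<delta> \<le> h" if "\<delta> \<in> F" for \<delta>
      unfolding h_def using that F(1) by (intro member_le_sum) auto
    ultimately show "\<exists>e. range e \<subseteq> univ N \<and> (\<forall>\<delta>\<in>F. sat N e \<delta>)" using h0 by blast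
  qed blast
  show ?thesis
    unfolding has_BTP_def
  proof (intro exI[of _ "\<lambda>\<eta>. map e (vars \<eta>)"] conjI allI impI)
    show "map e (vars \<eta>) \<in> tuples N m" for \<eta>
      using range_subsetD[OF e_univ] by (auto simp: tuples_def vars_def)
  next
    fix l assume l: "left_leaning l"
    show "consistent N n (range (\<lambda>i. (\<phi>, map e (vars (l i)))))"
      unfolding consistent_def
    proof (intro allI impI)
      fix F assume F: "finite F \<and> F \<subseteq> range (\<lambda>i. (\<phi>, map e (vars (l i))))"
      then obtain I where I: "finite I" "F = (\<lambda>i. (\<phi>, map e (vars (l i)))) ` I"
        using finite_subset_image[of F "\<lambda>i. (\<phi>, map e (vars (l i)))" UNIV] by auto
      obtain r where r: "I \<subseteq> {..<r}" using I(1) by (auto simp: finite_nat_set_iff_bounded)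
      have "sat N e (\<gamma> (map l [0..<r]))" using l by (intro e) (auto simp: \<Gamma>\<^sub>l_def)
      then obtain y where "y \<in> tuples N n" "\<forall>t<r. holds N \<phi> (y @ map e (vars (l t)))"
        unfolding \<gamma> by auto
      then have "realizes N n y F" using r by (auto simp: realizes_def I(2))
      then show "\<exists>y. realizes N n y F" ..
    qed
  next
    fix \<rho> assume \<rho>: "right_veering \<rho>"
    show "k_inconsistent N n k (\<lambda>i. (\<phi>, map e (vars (\<rho> i))))"
      unfolding k_inconsistent_def
    proof (intro allI impI notI)
      fix I assume I: "finite I \<and> card I = k"
        and "consistent N n ((\<lambda>i. (\<phi>, map e (vars (\<rho> i)))) ` I)"
      then obtain y where y: "realizes N n y ((\<lambda>i. (\<phi>, map e (vars (\<rho> i)))) ` I)"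
        using consistentD[of N n _ "(\<lambda>i. (\<phi>, map e (vars (\<rho> i)))) ` I"] by auto
      have "sat N e (Neg (\<gamma> (map \<rho> (sorted_list_of_set I))))"
        using \<rho> I by (intro e) (auto simp: \<Gamma>\<^sub>r_def)
      then have "\<not> (\<exists>y\<in>tuples N n. \<forall>t\<in>I. holds N \<phi> (y @ map e (vars (\<rho> t))))"
        using I by (simp add: \<gamma>)
      then show False using y by (auto simp: realizes_def)
    qed
  qed
qed

end

section \<open>New Kim's Lemma from the absence of bizarre trees\<close>

theorem theorem5p2:
  fixes L :: "('f, 'r) lang"
    and T :: "('f, 'r) fm set"
    and \<MM> :: "('f, 'r, 'a) struct"
    and \<kappa> :: "'k rel"
  assumes "complete_theory L T"
    and "monster \<kappa> L T \<MM>"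
    and "NBTP L \<MM>"
  shows "new_kims_lemma \<kappa> L \<MM>"
  unfolding new_kims_lemma_def
proof (intro allI impI notI)
  fix M n \<phi> b p c
  assume "elem_submodel L M \<MM> \<and> small \<kappa> M \<and> (\<phi>, b) \<in> pformulas L n (univ \<MM>) \<and>
    kim_divides L \<MM> M n \<phi> b"
  then have M: "M \<subseteq> univ \<MM>" "small \<kappa> M" and \<phi>: "\<phi> \<in> formulas L (n + length b)"
    and div: "kim_divides L \<MM> M n \<phi> b"
    by (auto simp: elem_submodel_def pformulas_def)
  assume "kim_strict \<kappa> L \<MM> M (length b) p \<and> tp L \<MM> b M \<subseteq> p \<and> morley_seq \<MM> M (length b) p c"
  then have p: "kim_strict \<kappa> L \<MM> M (length b) p" "tp L \<MM> b M \<subseteq> p"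
    and c: "morley_seq \<MM> M (length b) p c"
    by auto
  assume p_con: "consistent \<MM> n (range (\<lambda>i. (\<phi>, c i)))"
  obtain q d where q: "invariant_type L \<MM> M (length b) q" "tp L \<MM> b M \<subseteq> q"
    and d: "morley_seq \<MM> M (length b) q d" and incon: "\<not> consistent \<MM> n (range (\<lambda>i. (\<phi>, d i)))"
    using div unfolding kim_divides_def by blast
  interpret tree_construction \<kappa> L \<MM> M "length b" p q d b
    using assms(2) M p q d
    by unfold_locales (auto simp: monster_def models_def)
  have \<phi>': "\<phi> \<in> formulas L (n + length b + length [])" using \<phi> by simp
  obtain F where F: "finite F" "F \<subseteq> range (\<lambda>i. (\<phi>, d i))" "\<nexists>y. realizes \<MM> n y F"
    using incon unfolding consistent_def by blast
  obtain I where I: "finite I" "F = (\<lambda>i. (\<phi>, d i)) ` I"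
    using finite_subset_image[OF F(1,2)] by blast
  obtain k where k: "I \<subseteq> {..<k}" using I(1) by (auto simp: finite_nat_set_iff_bounded)
  have "has_BTP \<MM> n (length b) \<phi> k"
  proof (rule has_BTP[OF \<phi>])
    fix xs assume xs: "rev_morley (length b) p xs"
    show "\<exists>y\<in>tuples \<MM> n. \<forall>x\<in>set xs. holds \<MM> \<phi> (y @ x)"
      using consistent_imp_common_solution[OF invariant_p c xs \<phi>'] p_con by simp
  next
    fix xs assume xs: "rev_morley (length b) q xs" "length xs = k"
    show "\<not> (\<exists>y\<in>tuples \<MM> n. \<forall>x\<in>set xs. holds \<MM> \<phi> (y @ x))"
    proof
      assume "\<exists>y\<in>tuples \<MM> n. \<forall>x\<in>set xs. holds \<MM> \<phi> (y @ x)"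
      then have "\<exists>y\<in>tuples \<MM> n. \<forall>x\<in>set (rev (map d [0..<k])). holds \<MM> \<phi> (y @ x)"
        using rev_morley_common_solution[OF q(1) xs(1) rev_morley_of_morley_seq[OF d] _ \<phi>', of k] xs(2)
        by simp
      then obtain y where "y \<in> tuples \<MM> n" "\<forall>i<k. holds \<MM> \<phi> (y @ d i)" by auto
      then have "realizes \<MM> n y F" using k by (auto simp: realizes_def I(2))
      then show False using F(3) by blast
    qed
  qed
  then show False using assms(3) \<phi> unfolding NBTP_def by blast
qed

end
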